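(* Let $0<m<M<\infty$, let $\mathcal{S}_A$ be a closed subset of $[m,M]$ with $m,M\in\mathcal{S}_A$, and consider the set of probability measures $\nu_0$ supported on $\mathcal{S}_A$ with $\operatorname{ess\,inf}(\nu_0)=m$ and $\operatorname{ess\,sup}(\nu_0)=M$, together with the transformation $T$ on this set defined in the context. For $p\in(0,1)$ let $\nu_p^*$ be the discrete measure with $\nu_p^*(\{m\})=p$, $\nu_p^*(\{M\})=1-p$. Let $$s(\lambda)=\frac{\sqrt{(M-\lambda)^2+(\lambda-m)^2}}{2(M-m)},\qquad\lambda^*\in\arg\min_{\lambda\in\mathcal{S}_A}s(\lambda).$$ Then: (i) The measure $\nu_p^*$ is a fixed point for the mapping $T^2$. (ii) Any fixed point $\nu_p^*$ with $p$ in $$\mathcal{I}_u=\left(0,\tfrac12-s(\lambda^* )\right)\cup\left(\tfrac12+s(\lambda^* ),1\right)$$ is an unstable fixed point for $T^2$. (iii) For any $p$ in the interval $$\mathcal{I}_s=\left(\tfrac12-s(\lambda^* ),\tfrac12+s(\lambda^* )\right),$$ $\nu_p^*$ is a stable fixed point for the mapping $T^2$.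
   Context: For a probability measure $\nu$ on the Borel sets of $(0,\infty)$: $\operatorname{ess\,inf}(\nu)=\sup\{\alpha:\nu\{x:x<\alpha\}=0\}$ and $\operatorname{ess\,sup}(\nu)=\inf\{\alpha:\nu\{x:x>\alpha\}=0\}$. The transformation $T$ maps $\nu$ to the probability measure $T(\nu)$ given by $$T(\nu)(\mathcal{A})=\int_{\mathcal{A}}\frac{(\lambda-\mu_1)^2}{D}\,\nu(d\lambda)$$ for Borel sets $\mathcal{A}$, where $\mu_1=\int\lambda\,\nu(d\lambda)$, $\mu_2=\int\lambda^2\,\nu(d\lambda)$, $D=\mu_2-\mu_1^2$. $T^2=T\circ T$. The set of measures is equipped with the Lévy–Prokhorov metric, which here is the Lévy distance between distribution functions: $d(\nu,\nu')=L(F,F')=\inf\{\epsilon: F'(x-\epsilon)-\epsilon\leq F(x)\leq F'(x+\epsilon)+\epsilon\ \forall x\}$, where $F,F'$ are the distribution functions of $\nu,\nu'$. Stability: a fixed point $\nu^*$ of a mapping $S$ on a metric space with distance $d(\cdot,\cdot)$ is called stable if $\forall\epsilon>0$ $\exists\alpha>0$ such that for any $\nu_0$ in the space with $d(\nu_0,\nu^* )<\alpha$, $d(S^n(\nu_0),\nu^* )<\epsilon$ for all $n>0$. It is unstable if it is not stable. Here $S=T^2$ and the metric space is the set of measures described in the claim. *)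

theory Defs
  imports "HOL-Probability.Probability"
begin

definition ess_inf :: "real measure \<Rightarrow> real" where
  "ess_inf \<nu> = Sup {\<alpha>. emeasure \<nu> {x. x < \<alpha>} = 0}"

definition ess_sup :: "real measure \<Rightarrow> real" where
  "ess_sup \<nu> = Inf {\<alpha>. emeasure \<nu> {x. x > \<alpha>} = 0}"

definition \<mu>\<^sub>1 :: "real measure \<Rightarrow> real" where
  "\<mu>\<^sub>1 \<nu> = (\<integral>x. x \<partial>\<nu>)"

definition \<mu>\<^sub>2 :: "real measure \<Rightarrow> real" where
  "\<mu>\<^sub>2 \<nu> = (\<integral>x. x\<^sup>2 \<partial>\<nu>)"

definition D :: "real measure \<Rightarrow> real" where
  "D \<nu> = \<mu>\<^sub>2 \<nu> - (\<mu>\<^sub>1 \<nu>)\<^sup>2"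

definition T :: "real measure \<Rightarrow> real measure" where
  "T \<nu> = density \<nu> (\<lambda>x. ennreal ((x - \<mu>\<^sub>1 \<nu>)\<^sup>2 / D \<nu>))"

text \<open>
  For distribution functions of probability measures, a negative \<open>\<epsilon>\<close> never satisfies the
  condition below (let \<open>x\<close> tend to infinity) and \<open>\<epsilon> = 1\<close> always does, so the real
  infimum is over a nonempty set bounded below by 0.
\<close>

definition levy_dist :: "real measure \<Rightarrow> real measure \<Rightarrow> real" where
  "levy_dist \<nu> \<nu>' = Inf {\<epsilon>. \<forall>x. cdf \<nu>' (x - \<epsilon>) - \<epsilon> \<le> cdf \<nu> x \<and> cdf \<nu> x \<le> cdf \<nu>' (x + \<epsilon>) + \<epsilon>}"

text \<open>
  Measures on the Borel sets of \<open>(0,\<infinity>)\<close> that are supported on a closed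
  \<open>A \<subseteq> [m,M]\<close>, \<open>m > 0\<close>, are represented as Borel measures on the whole line
  that give full mass to \<open>A\<close>.
\<close>

definition measures_on :: "real set \<Rightarrow> real \<Rightarrow> real \<Rightarrow> real measure set" where
  "measures_on A m M =
    {\<nu>. real_distribution \<nu> \<and> emeasure \<nu> A = 1 \<and> ess_inf \<nu> = m \<and> ess_sup \<nu> = M}"

definition two_point :: "real \<Rightarrow> real \<Rightarrow> real \<Rightarrow> real measure" where
  "two_point m M p = distr (measure_pmf (bernoulli_pmf p)) borel (\<lambda>b. if b then m else M)"

lemma two_point_masses:
  assumes "m < M" "0 < p" "p < 1"
  shows "measure (two_point m M p) {m} = p" "measure (two_point m M p) {M} = 1 - p"
proof -
  have "(\<lambda>b. if b then m else M) -` {m} = {True}" "(\<lambda>b. if b then m else M) -` {M} = {False}"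
    using assms(1) by (auto split: if_splits)
  then show "measure (two_point m M p) {m} = p" "measure (two_point m M p) {M} = 1 - p"
    using assms by (simp_all add: two_point_def measure_distr measure_pmf_single)
qed

definition s :: "real \<Rightarrow> real \<Rightarrow> real \<Rightarrow> real" where
  "s m M x = sqrt ((M - x)\<^sup>2 + (x - m)\<^sup>2) / (2 * (M - m))"

definition fixed_point :: "'a set \<Rightarrow> ('a \<Rightarrow> 'a) \<Rightarrow> 'a \<Rightarrow> bool" where
  "fixed_point X S x \<longleftrightarrow> x \<in> X \<and> S x = x"

definition stable_fixed_point ::
    "'a set \<Rightarrow> ('a \<Rightarrow> 'a \<Rightarrow> real) \<Rightarrow> ('a \<Rightarrow> 'a) \<Rightarrow> 'a \<Rightarrow> bool" where
  "stable_fixed_point X d S x \<longleftrightarrow> fixed_point X S x \<and>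
    (\<forall>\<epsilon>>0. \<exists>\<alpha>>0. \<forall>y\<in>X. d y x < \<alpha> \<longrightarrow> (\<forall>n>0. d ((S ^^ n) y) x < \<epsilon>))"

definition unstable_fixed_point ::
    "'a set \<Rightarrow> ('a \<Rightarrow> 'a \<Rightarrow> real) \<Rightarrow> ('a \<Rightarrow> 'a) \<Rightarrow> 'a \<Rightarrow> bool" where
  "unstable_fixed_point X d S x \<longleftrightarrow> fixed_point X S x \<and> \<not> stable_fixed_point X d S x"

end

(* Write w(x) = (M - x) * (x - m) (bump), let a and a' be the means of \<nu> and T \<nu>, and e the integral
   of w (defect), which measures how far \<nu> is from living on {m, M}; then D = (M - a) * (a - m) - e.  Two steps of T
   multiply \<nu> by g^2 / (D D') with g(x) = (x - a) * (x - a').  The function r = D - g is the residual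
   of the linear regression of w on x under \<nu>: it is orthogonal to 1 and x, and its inner product with
   w is \<rho> = ||r||^2.  Hence D D' = D^2 + \<rho>, and after two steps
     D D' (e'' - e) <= - (2 D - max w) \<rho>,    D D' |a'' - a| <= (M - m) \<rho>.
   The condition p in I_s says precisely that 2 D > max w at the fixed point, so near it K e + |a - a*|
   is a Lyapunov function for large K, without any assumption on how A accumulates at m and M.  The
   Levy distance to the fixed point is small iff e and |a - a*| are.  If p is in I_u, then 2 D < w(l)
   and an atom at l, however small, is multiplied at every step of T^2 by a factor at least
   \<kappa> > 1 as long as the iterates stay near the fixed point. *)

theory Submission imports Defs begin

section \<open>Two steps of the transformation\<close>

locale compact_interval_set =
  fixes m M :: real and A :: "real set"
  assumes m_less_M: "m < M" and closed_A: "closed A" and A_subset: "A \<subseteq> {m..M}"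
    and m_in_A: "m \<in> A" and M_in_A: "M \<in> A"
begin

text \<open>The class in which iterates are followed: \<open>measures_onD\<close> places every
  measure of \<open>measures_on A m M\<close> in it, and \<open>T\<close> preserves it as long as
  \<open>D\<close> is positive.\<close>

definition carried :: "real measure \<Rightarrow> bool" where
  "carried \<nu> \<longleftrightarrow> real_distribution \<nu> \<and> (AE x in \<nu>. x \<in> A)"

definition bump :: "real \<Rightarrow> real" where
  "bump x = (M - x) * (x - m)"

definition defect :: "real measure \<Rightarrow> real" where
  "defect \<nu> = (\<integral>x. bump x \<partial>\<nu>)"

lemma A_borel [measurable]: "A \<in> sets borel"
  using closed_A by simp

lemma carried_real_distribution: "carried \<nu> \<Longrightarrow> real_distribution \<nu>"
  by (simp add: carried_def)

lemma carried_AE: "carried \<nu> \<Longrightarrow> AE x in \<nu>. x \<in> A"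
  by (simp add: carried_def)

lemma carried_AE_interval: "carried \<nu> \<Longrightarrow> AE x in \<nu>. m \<le> x \<and> x \<le> M"
  using A_subset by (auto dest!: carried_AE elim!: eventually_mono)

lemma continuous_bump [continuous_intros]: "continuous_on S bump"
  unfolding bump_def by (intro continuous_intros)

lemma bump_nonneg: "m \<le> x \<Longrightarrow> x \<le> M \<Longrightarrow> 0 \<le> bump x"
  by (simp add: bump_def)

lemma bump_le_square: "m \<le> x \<Longrightarrow> x \<le> M \<Longrightarrow> bump x \<le> (M - m)\<^sup>2"
  unfolding bump_def power2_eq_square by (intro mult_mono) auto

text \<open>A continuous function is bounded on the compact interval \<open>{m..M}\<close>, outside
  which \<nu> has no mass.\<close>

lemma integrable_continuous:
  fixes f :: "real \<Rightarrow> real"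
  assumes "carried \<nu>" and "continuous_on UNIV f"
  shows "integrable \<nu> f"
proof -
  interpret real_distribution \<nu> using assms carried_real_distribution by blast
  have "compact (f ` {m..M})"
    using assms(2) by (intro compact_continuous_image) (auto intro: continuous_on_subset)
  then obtain B where B: "\<And>x. x \<in> {m..M} \<Longrightarrow> norm (f x) \<le> B"
    using compact_imp_bounded bounded_iff by (metis imageI)
  have "AE x in \<nu>. norm (f x) \<le> B"
    using carried_AE_interval[OF assms(1)] by eventually_elim (use B in auto)
  moreover have "f \<in> borel_measurable \<nu>"
    using borel_measurable_continuous_onI[OF assms(2)] by simp
  ultimately show ?thesis by (rule integrable_const_bound)
qed

lemma integral_mono_carried:
  fixes f g :: "real \<Rightarrow> real"
  assumes "carried \<nu>" and "integrable \<nu> f" "integrable \<nu> g" and "\<And>x. x \<in> A \<Longrightarrow> f x \<le> g x"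
  shows "(\<integral>x. f x \<partial>\<nu>) \<le> (\<integral>x. g x \<partial>\<nu>)"
  using assms(2,3) carried_AE[OF assms(1)] by (intro integral_mono_AE) (auto elim!: eventually_mono intro: assms(4))

lemma carried_space: "carried \<nu> \<Longrightarrow> measure \<nu> (space \<nu>) = 1" "carried \<nu> \<Longrightarrow> space \<nu> = UNIV"
  "carried \<nu> \<Longrightarrow> measure \<nu> UNIV = 1"
proof -
  assume "carried \<nu>"
  then interpret real_distribution \<nu> by (rule carried_real_distribution)
  show "measure \<nu> (space \<nu>) = 1" "space \<nu> = UNIV" "measure \<nu> UNIV = 1"
    using prob_space by simp_all
qed

lemmas carried_simps = integrable_continuous continuous_bump continuous_on_add continuous_on_diff continuous_on_mult
  continuous_on_power continuous_on_const continuous_on_id continuous_on_minus carried_space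

section \<open>First two moments of a carried measure\<close>

lemma mean_bounds:
  assumes "carried \<nu>"
  shows "m \<le> \<mu>\<^sub>1 \<nu>" "\<mu>\<^sub>1 \<nu> \<le> M"
proof -
  have "(\<integral>x. m \<partial>\<nu>) \<le> \<mu>\<^sub>1 \<nu>" "\<mu>\<^sub>1 \<nu> \<le> (\<integral>x. M \<partial>\<nu>)"
    unfolding \<mu>\<^sub>1_def using assms A_subset
    by (intro integral_mono_carried; auto simp: carried_simps)+
  then show "m \<le> \<mu>\<^sub>1 \<nu>" "\<mu>\<^sub>1 \<nu> \<le> M" using assms by (simp_all add: carried_simps)
qed

lemma centred: "carried \<nu> \<Longrightarrow> (\<integral>x. x - \<mu>\<^sub>1 \<nu> \<partial>\<nu>) = 0"
  by (simp add: carried_simps) (simp add: \<mu>\<^sub>1_def)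

lemma D_eq:
  assumes "carried \<nu>"
  shows "(\<integral>x. (x - \<mu>\<^sub>1 \<nu>)\<^sup>2 \<partial>\<nu>) = D \<nu>"
proof -
  have "(\<integral>x. (x - \<mu>\<^sub>1 \<nu>)\<^sup>2 \<partial>\<nu>) = (\<integral>x. x\<^sup>2 - 2 * \<mu>\<^sub>1 \<nu> * x + (\<mu>\<^sub>1 \<nu>)\<^sup>2 \<partial>\<nu>)"
    by (simp add: power2_diff algebra_simps)
  also have "\<dots> = D \<nu>"
    using assms by (simp add: carried_simps) (simp add: D_def \<mu>\<^sub>1_def \<mu>\<^sub>2_def power2_eq_square)
  finally show ?thesis .
qed

text \<open>\<open>bump x\<close> equals \<open>(m + M) * x - m * M - x\<^sup>2\<close>, so its
  integral is a combination of the first two moments, from which the second can be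
  eliminated.\<close>

lemma D_eq_defect:
  assumes "carried \<nu>"
  shows "D \<nu> = (M - \<mu>\<^sub>1 \<nu>) * (\<mu>\<^sub>1 \<nu> - m) - defect \<nu>"
proof -
  have "defect \<nu> = (\<integral>x. (m + M) * x - m * M - x\<^sup>2 \<partial>\<nu>)"
    unfolding defect_def bump_def by (simp add: power2_eq_square algebra_simps)
  also have "\<dots> = (m + M) * \<mu>\<^sub>1 \<nu> - m * M - \<mu>\<^sub>2 \<nu>"
    using assms by (simp add: carried_simps) (simp add: \<mu>\<^sub>1_def \<mu>\<^sub>2_def)
  finally show ?thesis by (simp add: D_def power2_eq_square algebra_simps)
qed

lemma defect_nonneg:
  assumes "carried \<nu>" shows "0 \<le> defect \<nu>"
proof -
  have "AE x in \<nu>. 0 \<le> bump x"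
    using carried_AE_interval[OF assms] by eventually_elim (simp add: bump_nonneg)
  then show ?thesis unfolding defect_def by (rule integral_nonneg_AE)
qed

section \<open>One step of the transformation\<close>

lemma integral_T:
  fixes f :: "real \<Rightarrow> real"
  assumes "carried \<nu>" "0 < D \<nu>" "f \<in> borel_measurable borel"
  shows "(\<integral>x. f x \<partial>(T \<nu>)) = (\<integral>x. f x * (x - \<mu>\<^sub>1 \<nu>)\<^sup>2 \<partial>\<nu>) / D \<nu>"
proof -
  interpret real_distribution \<nu> using assms carried_real_distribution by blast
  have "(\<integral>x. f x \<partial>(T \<nu>)) = (\<integral>x. ((x - \<mu>\<^sub>1 \<nu>)\<^sup>2 / D \<nu>) *\<^sub>R f x \<partial>\<nu>)"
    unfolding T_def using assms by (intro integral_density) auto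
  also have "\<dots> = (\<integral>x. (f x * (x - \<mu>\<^sub>1 \<nu>)\<^sup>2) / D \<nu> \<partial>\<nu>)"
    by (simp add: mult.commute)
  finally show ?thesis by simp
qed

text \<open>The total mass is the variance divided by \<open>D \<nu>\<close>, which is 1 by
  \<open>D_eq\<close>; a density creates no mass outside \<open>A\<close>.\<close>

lemma carried_T:
  assumes "carried \<nu>" "0 < D \<nu>"
  shows "carried (T \<nu>)"
proof -
  interpret real_distribution \<nu> using assms carried_real_distribution by blast
  have "emeasure (T \<nu>) (space (T \<nu>)) = (\<integral>\<^sup>+x. ennreal ((x - \<mu>\<^sub>1 \<nu>)\<^sup>2 / D \<nu>) \<partial>\<nu>)"
    unfolding T_def by (simp add: emeasure_density)
  also have "\<dots> = ennreal (\<integral>x. (x - \<mu>\<^sub>1 \<nu>)\<^sup>2 / D \<nu> \<partial>\<nu>)"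
    using assms by (intro nn_integral_eq_integral) (auto simp: carried_simps)
  also have "\<dots> = 1"
    using assms D_eq by simp
  finally have "prob_space (T \<nu>)" by (intro prob_spaceI)
  then have "real_distribution (T \<nu>)"
    by (intro real_distribution.intro real_distribution_axioms.intro) (simp_all add: T_def)
  moreover have "AE x in T \<nu>. x \<in> A"
    unfolding T_def using carried_AE[OF assms(1)] by (subst AE_density) (auto elim!: eventually_mono)
  ultimately show ?thesis by (simp add: carried_def)
qed

section \<open>The regression residual of two steps\<close>

definition residual :: "real measure \<Rightarrow> real \<Rightarrow> real" where
  "residual \<nu> x = D \<nu> - (x - \<mu>\<^sub>1 \<nu>) * (x - \<mu>\<^sub>1 (T \<nu>))"

definition residual_var :: "real measure \<Rightarrow> real" where
  "residual_var \<nu> = (\<integral>x. (residual \<nu> x)\<^sup>2 \<partial>\<nu>)"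

lemma continuous_residual: "continuous_on S (residual \<nu>)"
  unfolding residual_def by (intro continuous_intros)

lemma residual_var_nonneg: "0 \<le> residual_var \<nu>"
  unfolding residual_var_def by simp

context
  fixes \<nu> assumes carried: "carried \<nu>" and D_pos: "0 < D \<nu>"
begin

lemma borel_bump [measurable]: "bump \<in> borel_measurable borel"
  by (intro borel_measurable_continuous_onI continuous_bump)

text \<open>With a and a' the means of \<nu> and \<open>T \<nu>\<close>, write (x - a) * (x - a') as
  (x - a)^2 + (a - a') * (x - a): the first term integrates to \<open>D \<nu>\<close>, the second to
  0.\<close>

lemma residual_centred: "(\<integral>x. residual \<nu> x \<partial>\<nu>) = 0"
proof -
  have "(\<integral>x. residual \<nu> x \<partial>\<nu>) =
      (\<integral>x. D \<nu> - ((x - \<mu>\<^sub>1 \<nu>)\<^sup>2 + (\<mu>\<^sub>1 \<nu> - \<mu>\<^sub>1 (T \<nu>)) * (x - \<mu>\<^sub>1 \<nu>)) \<partial>\<nu>)"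
    unfolding residual_def by (simp add: power2_eq_square algebra_simps)
  also have "\<dots> = D \<nu> - ((\<integral>x. (x - \<mu>\<^sub>1 \<nu>)\<^sup>2 \<partial>\<nu>) + (\<mu>\<^sub>1 \<nu> - \<mu>\<^sub>1 (T \<nu>)) * (\<integral>x. x - \<mu>\<^sub>1 \<nu> \<partial>\<nu>))"
    using carried
    by (subst Bochner_Integration.integral_diff Bochner_Integration.integral_add,
        simp_all add: carried_simps del: Bochner_Integration.integral_diff)+
  finally show ?thesis
    using centred[OF carried] D_eq[OF carried] by simp
qed

text \<open>This is the definition of the mean of \<open>T \<nu>\<close> in disguise: x minus that
  mean integrates to 0 against \<open>T \<nu>\<close>, that is, against \<nu> with the weight
  \<open>(x - \<mu>\<^sub>1 \<nu>)\<^sup>2\<close>.\<close>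

lemma residual_orthogonal: "(\<integral>x. (x - \<mu>\<^sub>1 \<nu>) * residual \<nu> x \<partial>\<nu>) = 0"
proof -
  have "(\<integral>x. (x - \<mu>\<^sub>1 (T \<nu>)) * (x - \<mu>\<^sub>1 \<nu>)\<^sup>2 \<partial>\<nu>) = 0"
    using integral_T[OF carried D_pos, of "\<lambda>x. x - \<mu>\<^sub>1 (T \<nu>)"] centred[OF carried_T[OF carried D_pos]] D_pos
    by simp
  moreover have "(\<integral>x. (x - \<mu>\<^sub>1 \<nu>) * residual \<nu> x \<partial>\<nu>) =
      (\<integral>x. D \<nu> * (x - \<mu>\<^sub>1 \<nu>) - (x - \<mu>\<^sub>1 (T \<nu>)) * (x - \<mu>\<^sub>1 \<nu>)\<^sup>2 \<partial>\<nu>)"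
    unfolding residual_def by (simp add: power2_eq_square algebra_simps)
  moreover have "\<dots> = D \<nu> * (\<integral>x. x - \<mu>\<^sub>1 \<nu> \<partial>\<nu>) - (\<integral>x. (x - \<mu>\<^sub>1 (T \<nu>)) * (x - \<mu>\<^sub>1 \<nu>)\<^sup>2 \<partial>\<nu>)"
    using carried by (subst Bochner_Integration.integral_diff) (auto simp: carried_simps)
  ultimately show ?thesis
    using centred[OF carried] by simp
qed

text \<open>\<open>bump\<close> and \<open>residual \<nu>\<close> are quadratics with the same
  leading coefficient -1, so they differ by an affine function, and that is orthogonal to the
  residual.\<close>

lemma bump_residual: "(\<integral>x. bump x * residual \<nu> x \<partial>\<nu>) = residual_var \<nu>"
proof -
  \<comment> \<open>\<beta> is the slope of the affine difference and \<gamma> its value at the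
    mean.\<close>
  define \<beta> where "\<beta> = m + M - \<mu>\<^sub>1 \<nu> - \<mu>\<^sub>1 (T \<nu>)"
  define \<gamma> where "\<gamma> = bump (\<mu>\<^sub>1 \<nu>) - residual \<nu> (\<mu>\<^sub>1 \<nu>)"
  have *: "bump x = residual \<nu> x + \<beta> * (x - \<mu>\<^sub>1 \<nu>) + \<gamma>" for x
    unfolding bump_def residual_def \<beta>_def \<gamma>_def by (simp add: algebra_simps)
  have "(\<integral>x. bump x * residual \<nu> x \<partial>\<nu>) = (\<integral>x. (residual \<nu> x)\<^sup>2 +
      (\<beta> * ((x - \<mu>\<^sub>1 \<nu>) * residual \<nu> x) + \<gamma> * residual \<nu> x) \<partial>\<nu>)"
    by (intro Bochner_Integration.integral_cong refl) (simp add: * power2_eq_square algebra_simps)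
  also have "\<dots> = residual_var \<nu> + (\<beta> * (\<integral>x. (x - \<mu>\<^sub>1 \<nu>) * residual \<nu> x \<partial>\<nu>) + \<gamma> * (\<integral>x. residual \<nu> x \<partial>\<nu>))"
    unfolding residual_var_def using carried
    by (subst Bochner_Integration.integral_add, simp_all add: carried_simps continuous_residual)+
  finally show ?thesis
    by (simp add: residual_centred residual_orthogonal)
qed

lemma integral_TT:
  fixes f :: "real \<Rightarrow> real"
  assumes "0 < D (T \<nu>)" "f \<in> borel_measurable borel"
  shows "D \<nu> * D (T \<nu>) * (\<integral>x. f x \<partial>(T (T \<nu>))) = (\<integral>x. f x * (D \<nu> - residual \<nu> x)\<^sup>2 \<partial>\<nu>)"
  using assms D_pos
    integral_T[OF carried_T[OF carried D_pos] assms]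
    integral_T[OF carried D_pos, of "\<lambda>x. f x * (x - \<mu>\<^sub>1 (T \<nu>))\<^sup>2"]
  by (simp add: residual_def power_mult_distrib mult_ac)

text \<open>Applied to 1, to \<open>bump\<close> and to \<open>x - \<mu>\<^sub>1 \<nu>\<close>,
  whose inner products with the residual are 0, \<open>residual_var \<nu>\<close> and 0.\<close>

lemma integral_square_expand:
  fixes f :: "real \<Rightarrow> real"
  assumes "continuous_on UNIV f"
  shows "(\<integral>x. f x * (D \<nu> - residual \<nu> x)\<^sup>2 \<partial>\<nu>) = (D \<nu>)\<^sup>2 * (\<integral>x. f x \<partial>\<nu>)
    - 2 * D \<nu> * (\<integral>x. f x * residual \<nu> x \<partial>\<nu>) + (\<integral>x. f x * (residual \<nu> x)\<^sup>2 \<partial>\<nu>)"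
proof -
  have "(\<integral>x. f x * (D \<nu> - residual \<nu> x)\<^sup>2 \<partial>\<nu>) = (\<integral>x. ((D \<nu>)\<^sup>2 * f x - 2 * D \<nu> * (f x * residual \<nu> x))
     + f x * (residual \<nu> x)\<^sup>2 \<partial>\<nu>)"
    by (intro Bochner_Integration.integral_cong refl) (simp add: power2_eq_square algebra_simps)
  then show ?thesis
    using carried assms by (simp add: carried_simps continuous_residual)
qed

text \<open>The product is the integral of the square of \<open>D \<nu> - residual \<nu> x\<close>;
  the cross term vanishes because the residual is centred.\<close>

lemma D_mult_D_T: "D \<nu> * D (T \<nu>) = (D \<nu>)\<^sup>2 + residual_var \<nu>"
proof -
  have "D \<nu> * D (T \<nu>) = (\<integral>x. (x - \<mu>\<^sub>1 (T \<nu>))\<^sup>2 * (x - \<mu>\<^sub>1 \<nu>)\<^sup>2 \<partial>\<nu>)"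
    using D_eq[OF carried_T[OF carried D_pos]] D_pos integral_T[OF carried D_pos, of "\<lambda>x. (x - \<mu>\<^sub>1 (T \<nu>))\<^sup>2"]
    by (simp add: field_simps)
  also have "\<dots> = (\<integral>x. 1 * (D \<nu> - residual \<nu> x)\<^sup>2 \<partial>\<nu>)"
    by (simp add: residual_def power_mult_distrib mult_ac)
  also have "\<dots> = (D \<nu>)\<^sup>2 + residual_var \<nu>"
    using integral_square_expand[of "\<lambda>_. 1"] carried
    by (simp add: residual_centred residual_var_def carried_space)
  finally show ?thesis .
qed

text \<open>By \<open>D_mult_D_T\<close> the product is at least \<open>(D \<nu>)\<^sup>2\<close>,
  so the second step never divides by zero.\<close>

lemma D_T_pos: "0 < D (T \<nu>)"
proof -
  have "0 < D \<nu> * D (T \<nu>)"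
    using D_mult_D_T D_pos residual_var_nonneg[of \<nu>] by (simp add: add_pos_nonneg)
  then show ?thesis using D_pos by (simp add: zero_less_mult_iff)
qed

lemma carried_TT: "carried (T (T \<nu>))"
  using carried_T[OF carried D_pos] D_T_pos carried_T by blast

section \<open>Change of the defect and of the mean over two steps\<close>

lemma defect_TT:
  "D \<nu> * D (T \<nu>) * defect (T (T \<nu>)) =
    (D \<nu>)\<^sup>2 * defect \<nu> - 2 * D \<nu> * residual_var \<nu> + (\<integral>x. bump x * (residual \<nu> x)\<^sup>2 \<partial>\<nu>)"
  unfolding defect_def
  by (simp add: integral_TT[OF D_T_pos] integral_square_expand continuous_bump bump_residual)

lemma mean_TT:
  "D \<nu> * D (T \<nu>) * (\<mu>\<^sub>1 (T (T \<nu>)) - \<mu>\<^sub>1 \<nu>) = (\<integral>x. (x - \<mu>\<^sub>1 \<nu>) * (residual \<nu> x)\<^sup>2 \<partial>\<nu>)"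
proof -
  have "\<mu>\<^sub>1 (T (T \<nu>)) - \<mu>\<^sub>1 \<nu> = (\<integral>x. x - \<mu>\<^sub>1 \<nu> \<partial>(T (T \<nu>)))"
    using carried_TT by (simp add: carried_simps) (simp add: \<mu>\<^sub>1_def)
  then show ?thesis
    using centred[OF carried]
    by (simp add: integral_TT[OF D_T_pos] integral_square_expand continuous_intros residual_orthogonal)
qed

text \<open>Since \<open>D \<nu> * D (T \<nu>)\<close> exceeds \<open>(D \<nu>)\<^sup>2\<close> by
  \<open>residual_var \<nu>\<close>, subtracting the old defect in \<open>defect_TT\<close> leaves
  an extra term \<open>- defect \<nu> * residual_var \<nu>\<close>, which has the favourable sign
  and is dropped.\<close>

lemma defect_TT_le:
  assumes "\<And>x. x \<in> A \<Longrightarrow> bump x \<le> W"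
  shows "D \<nu> * D (T \<nu>) * (defect (T (T \<nu>)) - defect \<nu>) \<le> - (2 * D \<nu> - W) * residual_var \<nu>"
proof -
  have "(\<integral>x. bump x * (residual \<nu> x)\<^sup>2 \<partial>\<nu>) \<le> (\<integral>x. W * (residual \<nu> x)\<^sup>2 \<partial>\<nu>)"
    using carried assms
    by (intro integral_mono_carried) (auto simp: carried_simps continuous_residual intro!: mult_right_mono)
  also have "\<dots> = W * residual_var \<nu>"
    by (simp add: residual_var_def)
  finally have "(\<integral>x. bump x * (residual \<nu> x)\<^sup>2 \<partial>\<nu>) \<le> W * residual_var \<nu>" .
  moreover have "0 \<le> defect \<nu> * residual_var \<nu>"
    using defect_nonneg[OF carried] residual_var_nonneg by simp
  ultimately show ?thesis
    using defect_TT D_mult_D_T by (simp add: algebra_simps)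
qed

lemma mean_TT_le:
  "D \<nu> * D (T \<nu>) * \<bar>\<mu>\<^sub>1 (T (T \<nu>)) - \<mu>\<^sub>1 \<nu>\<bar> \<le> (M - m) * residual_var \<nu>"
proof -
  have "D \<nu> * D (T \<nu>) * \<bar>\<mu>\<^sub>1 (T (T \<nu>)) - \<mu>\<^sub>1 \<nu>\<bar> = \<bar>\<integral>x. (x - \<mu>\<^sub>1 \<nu>) * (residual \<nu> x)\<^sup>2 \<partial>\<nu>\<bar>"
    using mean_TT D_pos D_T_pos by (metis abs_mult abs_of_pos mult_pos_pos)
  also have "\<dots> \<le> (\<integral>x. \<bar>(x - \<mu>\<^sub>1 \<nu>) * (residual \<nu> x)\<^sup>2\<bar> \<partial>\<nu>)"
    by (rule integral_abs_bound)
  also have "\<dots> \<le> (\<integral>x. (M - m) * (residual \<nu> x)\<^sup>2 \<partial>\<nu>)"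
  proof (intro integral_mono_carried[OF carried])
    show "\<bar>(x - \<mu>\<^sub>1 \<nu>) * (residual \<nu> x)\<^sup>2\<bar> \<le> (M - m) * (residual \<nu> x)\<^sup>2" if "x \<in> A" for x
    proof -
      have "\<bar>x - \<mu>\<^sub>1 \<nu>\<bar> \<le> M - m"
        using A_subset that mean_bounds[OF carried] by (auto simp: abs_le_iff)
      then show ?thesis by (auto simp: abs_mult intro!: mult_right_mono)
    qed
  qed (auto simp: carried carried_simps continuous_residual intro!: integrable_abs)
  also have "\<dots> = (M - m) * residual_var \<nu>"
    by (simp add: residual_var_def)
  finally show ?thesis .
qed

text \<open>Both changes are controlled by the same \<open>residual_var \<nu>\<close>, so a large
  enough multiple \<open>K\<close> of the decrease of the defect pays for the drift of the mean. The
  target \<open>c\<close> is arbitrary because the triangle inequality turns a bound on the drift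
  into one on the distance to \<open>c\<close>.\<close>

lemma lyapunov_step:
  assumes W: "\<And>x. x \<in> A \<Longrightarrow> bump x \<le> W" and K: "0 \<le> K" "M - m \<le> K * (2 * D \<nu> - W)"
  shows "K * defect (T (T \<nu>)) + \<bar>\<mu>\<^sub>1 (T (T \<nu>)) - c\<bar> \<le> K * defect \<nu> + \<bar>\<mu>\<^sub>1 \<nu> - c\<bar>"
proof -
  let ?P = "D \<nu> * D (T \<nu>)" and ?e = "defect (T (T \<nu>)) - defect \<nu>"
    and ?a = "\<bar>\<mu>\<^sub>1 (T (T \<nu>)) - \<mu>\<^sub>1 \<nu>\<bar>"
  have "?P * (K * ?e + ?a) = K * (?P * ?e) + ?P * ?a"
    by (simp add: algebra_simps)
  also have "\<dots> \<le> K * (- (2 * D \<nu> - W) * residual_var \<nu>) + (M - m) * residual_var \<nu>"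
    using defect_TT_le[OF W] mean_TT_le K(1) by (intro add_mono mult_left_mono) auto
  also have "\<dots> = ((M - m) - K * (2 * D \<nu> - W)) * residual_var \<nu>"
    by (simp add: algebra_simps)
  also have "\<dots> \<le> 0"
    using K(2) residual_var_nonneg by (intro mult_nonpos_nonneg) auto
  finally have "K * ?e + ?a \<le> 0"
    using D_pos D_T_pos by (simp add: mult_le_0_iff)
  then show ?thesis by (simp add: algebra_simps)
qed

text \<open>For a measure living on the two end points, \<open>T\<close> reflects the mean about the
  midpoint; the defect bounds the deviation from this. It locates the mean of the intermediate
  measure in the instability proof.\<close>

lemma mean_T_near:
  "\<bar>\<mu>\<^sub>1 (T \<nu>) - (m + M - \<mu>\<^sub>1 \<nu>)\<bar> \<le> (M - m) * defect \<nu> / D \<nu>"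
proof -
  let ?a = "\<mu>\<^sub>1 \<nu>"
  have "\<mu>\<^sub>1 (T \<nu>) - (m + M - ?a) = (\<integral>x. x - (m + M - ?a) \<partial>(T \<nu>))"
    using carried_T[OF carried D_pos] by (simp add: carried_simps) (simp add: \<mu>\<^sub>1_def)
  also have "\<dots> = (\<integral>x. (x - (m + M - ?a)) * (x - ?a)\<^sup>2 \<partial>\<nu>) / D \<nu>"
    by (rule integral_T[OF carried D_pos]) simp
  \<comment> \<open>The factor \<open>(x - (m + M - ?a)) * (x - ?a)\<close> equals
    \<open>bump ?a - bump x\<close>.\<close>
  also have "(\<integral>x. (x - (m + M - ?a)) * (x - ?a)\<^sup>2 \<partial>\<nu>) =
      (\<integral>x. bump ?a * (x - ?a) - (x - ?a) * bump x \<partial>\<nu>)"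
    by (intro Bochner_Integration.integral_cong refl) (simp add: bump_def power2_eq_square algebra_simps)
  also have "\<dots> = bump ?a * (\<integral>x. x - ?a \<partial>\<nu>) - (\<integral>x. (x - ?a) * bump x \<partial>\<nu>)"
    using carried by (subst Bochner_Integration.integral_diff) (auto simp: carried_simps)
  also have "\<dots> = - (\<integral>x. (x - ?a) * bump x \<partial>\<nu>)"
    using centred[OF carried] by simp
  finally have "\<bar>\<mu>\<^sub>1 (T \<nu>) - (m + M - ?a)\<bar> = \<bar>\<integral>x. (x - ?a) * bump x \<partial>\<nu>\<bar> / D \<nu>"
    using D_pos by simp
  also have "\<bar>\<integral>x. (x - ?a) * bump x \<partial>\<nu>\<bar> \<le> (\<integral>x. \<bar>(x - ?a) * bump x\<bar> \<partial>\<nu>)"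
    by (rule integral_abs_bound)
  also have "\<dots> \<le> (\<integral>x. (M - m) * bump x \<partial>\<nu>)"
  proof (intro integral_mono_carried[OF carried])
    show "\<bar>(x - ?a) * bump x\<bar> \<le> (M - m) * bump x" if "x \<in> A" for x
    proof -
      have "\<bar>x - ?a\<bar> \<le> M - m" and "0 \<le> bump x"
        using A_subset that mean_bounds[OF carried] by (auto simp: abs_le_iff intro!: bump_nonneg)
      then show ?thesis by (auto simp: abs_mult intro!: mult_right_mono)
    qed
  qed (auto simp: carried carried_simps intro!: integrable_abs)
  finally show ?thesis
    using D_pos by (simp add: defect_def divide_right_mono)
qed

end

end

section \<open>The Levy distance to a two-point measure\<close>

text \<open>The defining condition is monotone in \<epsilon>, so it passes from some \<epsilon>
  below \<alpha> to \<alpha> itself. The value 1 is always admissible, which makes the infimum one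
  over a nonempty set.\<close>

lemma levy_dist_lessD:
  assumes "real_distribution \<nu>" "real_distribution \<nu>'" and "levy_dist \<nu> \<nu>' < \<alpha>"
  shows "cdf \<nu>' (x - \<alpha>) - \<alpha> \<le> cdf \<nu> x" "cdf \<nu> x \<le> cdf \<nu>' (x + \<alpha>) + \<alpha>"
proof -
  interpret \<nu>: real_distribution \<nu> by fact
  interpret \<nu>': real_distribution \<nu>' by fact
  let ?E = "{\<epsilon>. \<forall>x. cdf \<nu>' (x - \<epsilon>) - \<epsilon> \<le> cdf \<nu> x \<and> cdf \<nu> x \<le> cdf \<nu>' (x + \<epsilon>) + \<epsilon>}"
  have "cdf \<nu>' (y - 1) - 1 \<le> cdf \<nu> y \<and> cdf \<nu> y \<le> cdf \<nu>' (y + 1) + 1" for y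
    using \<nu>.cdf_nonneg[of y] \<nu>.cdf_bounded_prob[of y]
      \<nu>'.cdf_nonneg[of "y + 1"] \<nu>'.cdf_bounded_prob[of "y - 1"] by linarith
  then have one: "1 \<in> ?E" by simp
  obtain \<epsilon> where \<epsilon>: "\<epsilon> \<in> ?E" "\<epsilon> < \<alpha>"
  proof (rule bexE[OF cInf_lessD[of ?E \<alpha>]])
    show "?E \<noteq> {}" using one by (metis empty_iff)
    show "Inf ?E < \<alpha>" using assms(3) by (simp only: levy_dist_def)
  qed
  have "cdf \<nu>' (x - \<alpha>) \<le> cdf \<nu>' (x - \<epsilon>)" "cdf \<nu>' (x + \<epsilon>) \<le> cdf \<nu>' (x + \<alpha>)"
    using \<epsilon>(2) by (auto intro!: \<nu>'.cdf_nondecreasing)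
  moreover have "cdf \<nu>' (x - \<epsilon>) - \<epsilon> \<le> cdf \<nu> x" "cdf \<nu> x \<le> cdf \<nu>' (x + \<epsilon>) + \<epsilon>"
    using \<epsilon>(1) by simp_all
  ultimately show "cdf \<nu>' (x - \<alpha>) - \<alpha> \<le> cdf \<nu> x" "cdf \<nu> x \<le> cdf \<nu>' (x + \<alpha>) + \<alpha>"
    using \<epsilon>(2) by linarith+
qed

lemma levy_dist_le:
  assumes "real_distribution \<nu>" "real_distribution \<nu>'"
    and "\<And>x. cdf \<nu>' (x - \<epsilon>) - \<epsilon> \<le> cdf \<nu> x" "\<And>x. cdf \<nu> x \<le> cdf \<nu>' (x + \<epsilon>) + \<epsilon>"
  shows "levy_dist \<nu> \<nu>' \<le> \<epsilon>"
proof -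
  interpret \<nu>: real_distribution \<nu> by fact
  interpret \<nu>': real_distribution \<nu>' by fact
  let ?E = "{\<epsilon>. \<forall>x. cdf \<nu>' (x - \<epsilon>) - \<epsilon> \<le> cdf \<nu> x \<and> cdf \<nu> x \<le> cdf \<nu>' (x + \<epsilon>) + \<epsilon>}"
  have "0 \<le> \<delta>" if "\<delta> \<in> ?E" for \<delta>
  proof -
    have "cdf \<nu> x \<le> 1 + \<delta>" for x
    proof -
      have "cdf \<nu> x \<le> cdf \<nu>' (x + \<delta>) + \<delta>" using that by simp
      then show ?thesis using \<nu>'.cdf_bounded_prob[of "x + \<delta>"] by linarith
    qed
    \<comment> \<open>Letting x tend to infinity rules out negative \<delta>, so the set is bounded
      below and \<open>cInf_lower\<close> applies.\<close>
    then have "1 \<le> 1 + \<delta>"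
      by (intro tendsto_upperbound[OF \<nu>.cdf_lim_at_top_prob] always_eventually) auto
    then show ?thesis by simp
  qed
  then have "bdd_below ?E" by (rule bdd_belowI[of _ 0])
  moreover have "\<epsilon> \<in> ?E" using assms(3,4) by simp
  ultimately show ?thesis unfolding levy_dist_def by (intro cInf_lower)
qed

text \<open>The two-point measure mixed with a point mass at \<open>l\<close> of weight
  \<open>t\<close>: the perturbed start that exhibits instability. The push-forward along the
  identity only moves the pmf to the Borel sigma-algebra.\<close>

definition three_point :: "real \<Rightarrow> real \<Rightarrow> real \<Rightarrow> real \<Rightarrow> real \<Rightarrow> real measure" where
  "three_point m M p l t = distr (measure_pmf (bind_pmf (bernoulli_pmf t) (\<lambda>b.
      if b then return_pmf l else map_pmf (\<lambda>b. if b then m else M) (bernoulli_pmf p)))) borel (\<lambda>x. x)"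

lemma real_distribution_three_point: "real_distribution (three_point m M p l t)"
  unfolding three_point_def by (rule prob_space.real_distribution_distr[OF measure_pmf.prob_space_axioms]) simp

lemma real_distribution_two_point: "real_distribution (two_point m M p)"
  unfolding two_point_def by (rule prob_space.real_distribution_distr[OF measure_pmf.prob_space_axioms]) simp

lemma integral_two_point:
  fixes f :: "real \<Rightarrow> real"
  assumes "0 < p" "p < 1" "f \<in> borel_measurable borel"
  shows "(\<integral>x. f x \<partial>(two_point m M p)) = p * f m + (1 - p) * f M"
  unfolding two_point_def using assms by (subst integral_distr) auto

lemma measure_two_point:
  assumes "0 < p" "p < 1" "B \<in> sets borel"
  shows "measure (two_point m M p) B = p * indicator B m + (1 - p) * indicator B M"
proof -
  interpret real_distribution "two_point m M p" by (rule real_distribution_two_point)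
  show ?thesis
    using integral_two_point[OF assms(1,2), of "indicator B" m M] assms(3) by simp
qed

lemma cdf_two_point:
  assumes "0 < p" "p < 1"
  shows "cdf (two_point m M p) x = p * of_bool (m \<le> x) + (1 - p) * of_bool (M \<le> x)"
  unfolding cdf_def using assms by (simp add: measure_two_point indicator_def)

lemma measure_three_point:
  assumes "0 < p" "p < 1" "0 \<le> t" "t \<le> 1" "B \<in> sets borel"
  shows "measure (three_point m M p l t) B =
    t * indicator B l + (1 - t) * (p * indicator B m + (1 - p) * indicator B M)"
proof -
  have "emeasure (three_point m M p l t) B = (\<integral>\<^sup>+b. emeasure (measure_pmf (if b then return_pmf l
      else map_pmf (\<lambda>b. if b then m else M) (bernoulli_pmf p))) B \<partial>bernoulli_pmf t)"
    unfolding three_point_def using assms(5) by (simp add: emeasure_distr)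
  also have "\<dots> = ennreal t * indicator B l + ennreal (1 - t) *
      emeasure (measure_pmf (map_pmf (\<lambda>b. if b then m else M) (bernoulli_pmf p))) B"
    using assms by (simp add: mult.commute)
  also have "emeasure (measure_pmf (map_pmf (\<lambda>b. if b then m else M) (bernoulli_pmf p))) B
     = (\<integral>\<^sup>+x. indicator B x \<partial>(map_pmf (\<lambda>b. if b then m else M) (bernoulli_pmf p)))"
    by (rule nn_integral_indicator[symmetric]) simp
  also have "\<dots> = ennreal p * indicator B m + ennreal (1 - p) * indicator B M"
    using assms by (simp add: mult.commute del: nn_integral_indicator)
  also have "ennreal t * indicator B l + ennreal (1 - t) * \<dots> =
      ennreal (t * indicator B l + (1 - t) * (p * indicator B m + (1 - p) * indicator B M))"
    using assms by (simp split: split_indicator flip: ennreal_plus ennreal_mult)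
  finally show ?thesis
    unfolding measure_def using assms by (simp only:) (intro enn2real_ennreal add_nonneg_nonneg mult_nonneg_nonneg; simp)
qed

section \<open>Membership in the space of measures, and the fixed points\<close>

context compact_interval_set
begin

lemma measures_onD: "\<nu> \<in> measures_on A m M \<Longrightarrow> carried \<nu>"
proof -
  assume \<nu>: "\<nu> \<in> measures_on A m M"
  then interpret real_distribution \<nu> by (simp add: measures_on_def)
  have "prob A = 1" using \<nu> by (simp add: measures_on_def measure_def)
  then show "carried \<nu>"
    using AE_prob_1 real_distribution_axioms by (auto simp: carried_def)
qed

text \<open>Nothing lies below \<open>m\<close> or above \<open>M\<close>, while any threshold above
  \<open>m\<close> or below \<open>M\<close> cuts off an atom; so the sets in \<open>ess_inf\<close>
  and \<open>ess_sup\<close> are exactly the half-lines \<open>{..m}\<close> and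
  \<open>{M..}\<close>.\<close>

lemma measures_onI:
  assumes "real_distribution \<nu>" "measure \<nu> A = 1" "0 < measure \<nu> {m}" "0 < measure \<nu> {M}"
  shows "\<nu> \<in> measures_on A m M"
proof -
  interpret real_distribution \<nu> by fact
  have outside: "emeasure \<nu> B = 0" if "B \<inter> A = {}" "B \<in> sets borel" for B
  proof -
    have "measure \<nu> (A \<union> B) = 1 + measure \<nu> B"
      using that assms(2) by (subst finite_measure_Union) auto
    then show ?thesis
      using prob_le_1[of "A \<union> B"] by (simp add: emeasure_eq_measure measure_le_0_iff)
  qed
  have pos: "emeasure \<nu> B \<noteq> 0" if "x \<in> B" "0 < measure \<nu> {x}" "B \<in> sets borel" for B x
    using that finite_measure_mono[of "{x}" B] by (auto simp: emeasure_eq_measure)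
  have "{\<alpha>. emeasure \<nu> {x. x < \<alpha>} = 0} = {..m}"
  proof -
    have "emeasure \<nu> {x. x < \<alpha>} = 0" if "\<alpha> \<le> m" for \<alpha>
      using A_subset that by (intro outside) auto
    moreover have "emeasure \<nu> {x. x < \<alpha>} \<noteq> 0" if "m < \<alpha>" for \<alpha>
      using that assms(3) by (intro pos[of m]) auto
    ultimately show ?thesis by (force simp: not_le[symmetric])
  qed
  moreover have "{\<alpha>. emeasure \<nu> {x. x > \<alpha>} = 0} = {M..}"
  proof -
    have "emeasure \<nu> {x. \<alpha> < x} = 0" if "M \<le> \<alpha>" for \<alpha>
      using A_subset that by (intro outside) auto
    moreover have "emeasure \<nu> {x. \<alpha> < x} \<noteq> 0" if "\<alpha> < M" for \<alpha>
      using that assms(4) by (intro pos[of M]) auto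
    ultimately show ?thesis by (force simp: not_le[symmetric])
  qed
  ultimately show ?thesis
    using assms by (simp add: measures_on_def ess_inf_def ess_sup_def emeasure_eq_measure)
qed

lemma two_point_in: "0 < p \<Longrightarrow> p < 1 \<Longrightarrow> two_point m M p \<in> measures_on A m M"
  using m_less_M m_in_A M_in_A
  by (intro measures_onI real_distribution_two_point) (auto simp: measure_two_point indicator_def)

lemma three_point_in:
  assumes "0 < p" "p < 1" "0 < t" "t < 1" "l \<in> A"
  shows "three_point m M p l t \<in> measures_on A m M"
proof (intro measures_onI real_distribution_three_point)
  show "measure (three_point m M p l t) A = 1"
    using assms m_in_A M_in_A by (simp add: measure_three_point algebra_simps)
  have "0 < (1 - t) * p" "0 < (1 - t) * (1 - p)" using assms by simp_all
  then show "0 < measure (three_point m M p l t) {m}" "0 < measure (three_point m M p l t) {M}"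
    using assms m_less_M by (auto simp: measure_three_point indicator_def add_nonneg_pos)
qed

lemma carried_two_point: "0 < p \<Longrightarrow> p < 1 \<Longrightarrow> carried (two_point m M p)"
  using two_point_in measures_onD by blast

lemma mean_two_point: "0 < p \<Longrightarrow> p < 1 \<Longrightarrow> \<mu>\<^sub>1 (two_point m M p) = p * m + (1 - p) * M"
  unfolding \<mu>\<^sub>1_def by (simp add: integral_two_point)

lemma D_two_point: "0 < p \<Longrightarrow> p < 1 \<Longrightarrow> D (two_point m M p) = p * (1 - p) * (M - m)\<^sup>2"
  unfolding D_def \<mu>\<^sub>2_def by (simp add: mean_two_point integral_two_point power2_eq_square algebra_simps)

text \<open>The squared distances of \<open>m\<close> and \<open>M\<close> from the mean are
  \<open>(1 - p)\<^sup>2\<close> and \<open>p\<^sup>2\<close> times \<open>(M - m)\<^sup>2\<close>,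
  and \<open>D\<close> is \<open>p * (1 - p) * (M - m)\<^sup>2\<close>: one step exchanges the two
  weights, so two steps restore them.\<close>

lemma T_two_point:
  assumes p: "0 < p" "p < 1"
  shows "T (two_point m M p) = two_point m M (1 - p)"
proof -
  let ?\<nu> = "two_point m M p"
  have D_pos: "0 < D ?\<nu>"
    using p m_less_M by (simp add: D_two_point)
  interpret T: real_distribution "T ?\<nu>"
    using carried_T[OF carried_two_point[OF p] D_pos] carried_real_distribution by blast
  interpret two: real_distribution "two_point m M (1 - p)" by (rule real_distribution_two_point)
  show ?thesis
  proof (rule measure_eqI)
    fix B assume "B \<in> sets (T ?\<nu>)"
    then have B: "B \<in> sets borel" by simp
    have "measure (T ?\<nu>) B = (\<integral>x. indicator B x * (x - \<mu>\<^sub>1 ?\<nu>)\<^sup>2 \<partial>?\<nu>) / D ?\<nu>"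
      using integral_T[OF carried_two_point[OF p] D_pos, of "indicator B"] B by simp
    also have "\<dots> = (p * (indicator B m * (m - \<mu>\<^sub>1 ?\<nu>)\<^sup>2) + (1 - p) * (indicator B M * (M - \<mu>\<^sub>1 ?\<nu>)\<^sup>2)) / D ?\<nu>"
      using p B by (subst integral_two_point) auto
    also have "m - \<mu>\<^sub>1 ?\<nu> = - ((1 - p) * (M - m))"
      using p by (simp add: mean_two_point algebra_simps)
    also have "M - \<mu>\<^sub>1 ?\<nu> = p * (M - m)"
      using p by (simp add: mean_two_point algebra_simps)
    also have "p * (indicator B m * (- ((1 - p) * (M - m)))\<^sup>2) + (1 - p) * (indicator B M * (p * (M - m))\<^sup>2)
        = ((1 - p) * indicator B m + (1 - (1 - p)) * indicator B M) * D ?\<nu>"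
      using p by (simp add: D_two_point power2_eq_square algebra_simps)
    also have "\<dots> / D ?\<nu> = (1 - p) * indicator B m + (1 - (1 - p)) * indicator B M"
      using D_pos by simp
    also have "\<dots> = measure (two_point m M (1 - p)) B"
      using p B by (simp add: measure_two_point)
    finally show "emeasure (T ?\<nu>) B = emeasure (two_point m M (1 - p)) B"
      by (simp add: T.emeasure_eq_measure two.emeasure_eq_measure)
  qed simp
qed

lemma fixed_point_two_point:
  assumes "0 < p" "p < 1"
  shows "fixed_point (measures_on A m M) (T \<circ> T) (two_point m M p)"
  using assms T_two_point[of p] T_two_point[of "1 - p"] two_point_in by (simp add: fixed_point_def)

section \<open>Levy distance against defect and mean\<close>

context
  fixes \<nu> and p :: real assumes carried: "carried \<nu>" and p: "0 < p" "p < 1"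
begin

interpretation \<nu>: real_distribution \<nu>
  using carried by (rule carried_real_distribution)

text \<open>Closeness forces mass at least \<open>p - \<alpha>\<close> near \<open>m\<close> and at
  least \<open>1 - p - \<alpha>\<close> near \<open>M\<close>. Hence at most
  \<open>2 * \<alpha>\<close> remains in the middle, where \<open>bump\<close> is at most
  \<open>(M - m)\<^sup>2\<close>; near the ends \<open>bump\<close> is itself of order
  \<alpha>.\<close>

lemma moments_near_two_point:
  assumes \<alpha>: "0 < \<alpha>" "4 * \<alpha> < M - m" and near: "levy_dist \<nu> (two_point m M p) < \<alpha>"
  shows "defect \<nu> \<le> 2 * \<alpha> * ((M - m)\<^sup>2 + (M - m))"
    and "\<bar>\<mu>\<^sub>1 \<nu> - (p * m + (1 - p) * M)\<bar> \<le> \<alpha> * (M - m + 2)"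
proof -
  note close = levy_dist_lessD[OF carried_real_distribution[OF carried] real_distribution_two_point near]
  \<comment> \<open>The right piece starts at \<open>M - 2 * \<alpha>\<close> because the comparison
    shifts the argument by \<alpha> and must still evaluate the two-point cdf strictly below its
    jump at \<open>M\<close>. The bound \<open>4 * \<alpha> < M - m\<close> keeps the pieces
    disjoint.\<close>
  let ?L = "{..m + \<alpha>}" and ?R = "{M - 2 * \<alpha><..}"
  have L: "p - \<alpha> \<le> measure \<nu> ?L"
    using close(1)[of "m + \<alpha>"] \<alpha> p m_less_M by (simp add: cdf_two_point) (simp add: cdf_def)
  have "measure \<nu> {..M - 2 * \<alpha>} \<le> p + \<alpha>"
    using close(2)[of "M - 2 * \<alpha>"] \<alpha> p m_less_M by (simp add: cdf_two_point) (simp add: cdf_def)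
  moreover have "measure \<nu> ?R = 1 - measure \<nu> {..M - 2 * \<alpha>}"
    using \<nu>.prob_compl[of "{..M - 2 * \<alpha>}"] by (simp add: Compl_eq_Diff_UNIV[symmetric] Compl_atMost)
  ultimately have R: "1 - p - \<alpha> \<le> measure \<nu> ?R" by simp
  have ind: "integrable \<nu> (indicator ?L :: real \<Rightarrow> real)" "integrable \<nu> (indicator ?R :: real \<Rightarrow> real)"
    by (simp_all add: \<nu>.emeasure_eq_measure)
  have "defect \<nu> \<le> (\<integral>x. (M - m)\<^sup>2 * (1 - indicator ?L x - indicator ?R x) + 2 * \<alpha> * (M - m) \<partial>\<nu>)"
    unfolding defect_def
  proof (intro integral_mono_carried[OF carried])
    fix x assume "x \<in> A"
    then have x: "m \<le> x" "x \<le> M" using A_subset by auto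
    define c where "c = 2 * \<alpha> * (M - m)"
    have "bump x \<le> (M - m) * (2 * \<alpha>)" if "x \<in> ?L"
      unfolding bump_def using x that \<alpha> by (intro mult_mono) auto
    then have "bump x \<le> c" if "x \<in> ?L"
      using that by (simp only: c_def mult_ac)
    moreover have "bump x \<le> c" if "x \<in> ?R"
      unfolding bump_def c_def using x that by (intro mult_mono) auto
    moreover have "x \<in> ?L \<Longrightarrow> x \<notin> ?R" and "0 \<le> c"
      using \<alpha> by (auto simp: c_def)
    ultimately show "bump x \<le> (M - m)\<^sup>2 * (1 - indicator ?L x - indicator ?R x) + 2 * \<alpha> * (M - m)"
      using bump_le_square[OF x] unfolding c_def[symmetric]
      by (cases "x \<in> ?L"; cases "x \<in> ?R") (simp_all del: atMost_iff greaterThan_iff)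
  qed (use carried ind in \<open>simp_all add: carried_simps\<close>)
  also have "\<dots> = (M - m)\<^sup>2 * (1 - measure \<nu> ?L - measure \<nu> ?R) + 2 * \<alpha> * (M - m)"
    using carried ind by (simp add: carried_space)
  also have "\<dots> \<le> (M - m)\<^sup>2 * (2 * \<alpha>) + 2 * \<alpha> * (M - m)"
    using L R \<alpha> by (intro add_mono mult_left_mono) auto
  finally show "defect \<nu> \<le> 2 * \<alpha> * ((M - m)\<^sup>2 + (M - m))"
    by (simp add: algebra_simps)
  \<comment> \<open>Markov's inequality for \<open>x - m\<close> on the right piece bounds the mean
    from below; further down, \<open>M - x\<close> on the left piece bounds it from above.\<close>
  have "(M - m - 2 * \<alpha>) * measure \<nu> ?R = (\<integral>x. (M - m - 2 * \<alpha>) * indicator ?R x \<partial>\<nu>)"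
    by simp
  also have "\<dots> \<le> (\<integral>x. x - m \<partial>\<nu>)"
    using carried ind A_subset \<alpha>
    by (intro integral_mono_carried) (simp_all add: carried_simps, auto split: split_indicator)
  also have "\<dots> = \<mu>\<^sub>1 \<nu> - m"
    using carried by (simp add: carried_simps) (simp add: \<mu>\<^sub>1_def)
  finally have "(M - m - 2 * \<alpha>) * (1 - p - \<alpha>) \<le> \<mu>\<^sub>1 \<nu> - m"
    using mult_left_mono[OF R, of "M - m - 2 * \<alpha>"] \<alpha> by linarith
  moreover have "2 * \<alpha> * (1 - p - \<alpha>) \<le> 2 * \<alpha>"
    using p \<alpha> by (simp add: mult_le_cancel_left)
  ultimately have lower: "p * m + (1 - p) * M - \<alpha> * (M - m + 2) \<le> \<mu>\<^sub>1 \<nu>"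
    by (simp add: algebra_simps)
  have "(M - m - \<alpha>) * measure \<nu> ?L = (\<integral>x. (M - m - \<alpha>) * indicator ?L x \<partial>\<nu>)"
    by simp
  also have "\<dots> \<le> (\<integral>x. M - x \<partial>\<nu>)"
    using carried ind A_subset \<alpha>
    by (intro integral_mono_carried) (simp_all add: carried_simps, auto split: split_indicator)
  also have "\<dots> = M - \<mu>\<^sub>1 \<nu>"
    using carried by (simp add: carried_simps) (simp add: \<mu>\<^sub>1_def)
  finally have "(M - m - \<alpha>) * (p - \<alpha>) \<le> M - \<mu>\<^sub>1 \<nu>"
    using mult_left_mono[OF L, of "M - m - \<alpha>"] \<alpha> by linarith
  moreover have "\<alpha> * (p - \<alpha>) \<le> \<alpha> * 2"
    using p \<alpha> by (intro mult_left_mono) auto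
  ultimately have "\<mu>\<^sub>1 \<nu> \<le> p * m + (1 - p) * M + \<alpha> * (M - m + 2)"
    by (simp add: algebra_simps)
  with lower show "\<bar>\<mu>\<^sub>1 \<nu> - (p * m + (1 - p) * M)\<bar> \<le> \<alpha> * (M - m + 2)"
    by (simp add: abs_le_iff)
qed

text \<open>Markov's inequality with a correction: at distance \<epsilon> or more from
  \<open>m\<close>, \<open>bump x / \<epsilon>\<close> is at least \<open>M - x\<close>, so
  \<open>(x - m) + bump x / \<epsilon>\<close> dominates \<open>M - m\<close> there. Its integral
  involves only mean and defect. The other tail is symmetric.\<close>

lemma levy_dist_two_point_le:
  assumes \<epsilon>: "0 < \<epsilon>"
    and near: "\<bar>\<mu>\<^sub>1 \<nu> - (p * m + (1 - p) * M)\<bar> + defect \<nu> / \<epsilon> \<le> (M - m) * \<epsilon>"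
  shows "levy_dist \<nu> (two_point m M p) \<le> \<epsilon>"
proof -
  have L_pos: "0 < M - m" using m_less_M by simp
  have integrable_ind: "integrable \<nu> (indicator B :: real \<Rightarrow> real)" if "B \<in> sets borel" for B
    using that by (simp add: \<nu>.emeasure_eq_measure)
  have upper_tail: "measure \<nu> {m + \<epsilon><..} \<le> 1 - p + \<epsilon>"
  proof -
    have "(M - m) * measure \<nu> {m + \<epsilon><..} = (\<integral>x. (M - m) * indicator {m + \<epsilon><..} x \<partial>\<nu>)"
      by simp
    also have "\<dots> \<le> (\<integral>x. (x - m) + bump x / \<epsilon> \<partial>\<nu>)"
    proof (intro integral_mono_carried[OF carried])
      fix x assume "x \<in> A"
      then have x: "m \<le> x" "x \<le> M" using A_subset by auto
      have "M - x \<le> bump x / \<epsilon>" if "m + \<epsilon> < x"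
        using x that \<epsilon> unfolding bump_def by (auto simp: pos_le_divide_eq intro!: mult_left_mono)
      then show "(M - m) * indicator {m + \<epsilon><..} x \<le> (x - m) + bump x / \<epsilon>"
        using x \<epsilon> bump_nonneg[OF x] by (auto simp: indicator_def)
    qed (use carried integrable_ind in \<open>auto simp: carried_simps intro!: Bochner_Integration.integrable_divide\<close>)
    also have "\<dots> = \<mu>\<^sub>1 \<nu> - m + defect \<nu> / \<epsilon>"
      using carried by (simp add: carried_simps) (simp add: \<mu>\<^sub>1_def defect_def)
    also have "\<dots> \<le> (M - m) * (1 - p + \<epsilon>)"
      using near by (simp add: algebra_simps abs_le_iff)
    finally show ?thesis using L_pos by simp
  qed
  have lower_tail: "measure \<nu> {..M - \<epsilon>} \<le> p + \<epsilon>"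
  proof -
    have "(M - m) * measure \<nu> {..M - \<epsilon>} = (\<integral>x. (M - m) * indicator {..M - \<epsilon>} x \<partial>\<nu>)"
      by simp
    also have "\<dots> \<le> (\<integral>x. (M - x) + bump x / \<epsilon> \<partial>\<nu>)"
    proof (intro integral_mono_carried[OF carried])
      fix x assume "x \<in> A"
      then have x: "m \<le> x" "x \<le> M" using A_subset by auto
      have "x - m \<le> bump x / \<epsilon>" if "x \<le> M - \<epsilon>"
        using x that \<epsilon> mult_right_mono[of \<epsilon> "M - x" "x - m"] unfolding bump_def
        by (simp add: pos_le_divide_eq mult.commute)
      then show "(M - m) * indicator {..M - \<epsilon>} x \<le> (M - x) + bump x / \<epsilon>"
        using x \<epsilon> bump_nonneg[OF x] by (auto simp: indicator_def)
    qed (use carried integrable_ind in \<open>auto simp: carried_simps intro!: Bochner_Integration.integrable_divide\<close>)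
    also have "\<dots> = M - \<mu>\<^sub>1 \<nu> + defect \<nu> / \<epsilon>"
      using carried by (simp add: carried_simps) (simp add: \<mu>\<^sub>1_def defect_def)
    also have "\<dots> \<le> (M - m) * (p + \<epsilon>)"
      using near by (simp add: algebra_simps abs_le_iff)
    finally show ?thesis using L_pos by simp
  qed
  have lower_tail': "p - \<epsilon> \<le> cdf \<nu> (m + \<epsilon>)"
    using upper_tail \<nu>.prob_compl[of "{..m + \<epsilon>}"]
    by (simp add: Compl_eq_Diff_UNIV[symmetric] Compl_atMost cdf_def)
  have top: "cdf \<nu> x = 1" if "M \<le> x" for x
  proof -
    have "AE y in \<nu>. y \<in> {..x}"
      using carried_AE_interval[OF carried] by eventually_elim (use that in auto)
    then show ?thesis
      unfolding cdf_def by (simp add: \<nu>.prob_eq_1)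
  qed
  show ?thesis
  proof (rule levy_dist_le)
    fix x
    show "cdf (two_point m M p) (x - \<epsilon>) - \<epsilon> \<le> cdf \<nu> x"
    proof -
      \<comment> \<open>The tail bound enters in the middle case, where the shifted two-point cdf is
        on its plateau \<open>p\<close>; the same holds for the second inequality.\<close>
      consider "M \<le> x" | "m + \<epsilon> \<le> x" "x < M" | "x < m + \<epsilon>" "x < M" by linarith
      then show ?thesis
      proof cases
        case 1 then show ?thesis using p \<epsilon> by (simp add: top cdf_two_point)
      next
        case 2
        then have "cdf \<nu> (m + \<epsilon>) \<le> cdf \<nu> x" by (intro \<nu>.cdf_nondecreasing)
        then show ?thesis using 2 p \<epsilon> lower_tail' by (simp add: cdf_two_point)
      next
        case 3
        then show ?thesis using p \<epsilon> \<nu>.cdf_nonneg[of x] by (simp add: cdf_two_point)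
      qed
    qed
    show "cdf \<nu> x \<le> cdf (two_point m M p) (x + \<epsilon>) + \<epsilon>"
    proof -
      consider "M \<le> x + \<epsilon>" | "m \<le> x + \<epsilon>" "x + \<epsilon> < M" | "x + \<epsilon> < m" by linarith
      then show ?thesis
      proof cases
        case 1
        then show ?thesis using p \<epsilon> m_less_M \<nu>.cdf_bounded_prob[of x] by (simp add: cdf_two_point)
      next
        case 2
        then have "cdf \<nu> x \<le> cdf \<nu> (M - \<epsilon>)" by (intro \<nu>.cdf_nondecreasing) simp
        then show ?thesis using 2 p \<epsilon> lower_tail by (simp add: cdf_two_point) (simp add: cdf_def)
      next
        case 3
        have "AE y in \<nu>. y \<notin> {..x}"
          using carried_AE_interval[OF carried] by eventually_elim (use 3 \<epsilon> in auto)
        then have "cdf \<nu> x = 0"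
          unfolding cdf_def by (simp add: \<nu>.prob_eq_0)
        then show ?thesis using 3 p \<epsilon> m_less_M by (simp add: cdf_two_point)
      qed
    qed
  qed (use carried_real_distribution[OF carried] real_distribution_two_point in auto)
qed

end

end

context compact_interval_set
begin

section \<open>Stability\<close>

lemma bump_diff_le:
  assumes "m \<le> x" "x \<le> M" "m \<le> y" "y \<le> M"
  shows "\<bar>bump x - bump y\<bar> \<le> (M - m) * \<bar>x - y\<bar>"
proof -
  have "bump x - bump y = (m + M - x - y) * (x - y)"
    by (simp add: bump_def algebra_simps)
  moreover have "\<bar>m + M - x - y\<bar> \<le> M - m"
    using assms by (simp add: abs_le_iff)
  ultimately show ?thesis
    by (simp add: abs_mult mult_right_mono)
qed

lemma bump_two_point_mean: "bump (p * m + (1 - p) * M) = p * (1 - p) * (M - m)\<^sup>2"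
  by (simp add: bump_def power2_eq_square algebra_simps)

text \<open>\<open>D \<nu>\<close> is \<open>bump\<close> at the mean minus the defect,
  \<open>bump\<close> is Lipschitz with constant \<open>M - m\<close>, and its value at the
  two-point mean is the variance of the fixed point.\<close>

lemma D_lower:
  assumes "carried \<nu>" "0 < p" "p < 1"
  shows "p * (1 - p) * (M - m)\<^sup>2 - (M - m) * \<bar>\<mu>\<^sub>1 \<nu> - (p * m + (1 - p) * M)\<bar> - defect \<nu> \<le> D \<nu>"
proof -
  let ?c = "p * m + (1 - p) * M"
  have "m \<le> ?c" "?c \<le> M"
    using mean_bounds[OF carried_two_point[OF assms(2,3)]] assms by (simp_all add: mean_two_point)
  then have "\<bar>bump (\<mu>\<^sub>1 \<nu>) - bump ?c\<bar> \<le> (M - m) * \<bar>\<mu>\<^sub>1 \<nu> - ?c\<bar>"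
    using mean_bounds[OF assms(1)] by (intro bump_diff_le)
  moreover have "D \<nu> = bump (\<mu>\<^sub>1 \<nu>) - defect \<nu>"
    using D_eq_defect[OF assms(1)] by (simp add: bump_def)
  ultimately show ?thesis
    unfolding bump_two_point_mean by linarith
qed

text \<open>A sublevel set of the Lyapunov function \<open>H\<close> is invariant under two steps.
  It is chosen inside the Levy ball of radius \<epsilon>, and it contains every carried measure in
  the Levy ball of radius \<alpha>.\<close>

theorem stable_two_point:
  assumes p: "0 < p" "p < 1" and W: "\<And>x. x \<in> A \<Longrightarrow> bump x \<le> W"
    and W_less: "W < 2 * (p * (1 - p) * (M - m)\<^sup>2)"
  shows "stable_fixed_point (measures_on A m M) levy_dist (T \<circ> T) (two_point m M p)"
  unfolding stable_fixed_point_def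
proof (intro conjI allI impI fixed_point_two_point[OF p])
  fix \<epsilon> :: real assume \<epsilon>: "0 < \<epsilon>"
  let ?c = "p * m + (1 - p) * M" and ?L = "M - m"
  define Dp where "Dp = p * (1 - p) * ?L\<^sup>2"
  \<comment> \<open>\<delta> is half the margin \<open>2 * Dp - W\<close>: if \<open>D \<nu>\<close>
    drops below \<open>Dp\<close> by at most \<open>\<delta> / 2\<close>, then
    \<open>2 * D \<nu> - W\<close> is still at least \<delta>, and \<open>K * \<delta> = ?L\<close>
    is what \<open>lyapunov_step\<close> asks for.\<close>
  define \<delta> where "\<delta> = (2 * Dp - W) / 2"
  define K where "K = ?L / \<delta>"
  define H where "H \<nu> = K * defect \<nu> + \<bar>\<mu>\<^sub>1 \<nu> - ?c\<bar>" for \<nu>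
  \<comment> \<open>The first bound keeps \<open>D\<close> within \<open>\<delta> / 2\<close> below
    \<open>Dp\<close>, the second makes the Levy distance at most \<open>\<epsilon> / 2\<close>. The
    denominator of \<alpha> below comes from \<open>moments_near_two_point\<close>.\<close>
  define \<eta> where "\<eta> = min (\<delta> / 2 / (?L + 1 / K)) (?L * (\<epsilon> / 2) / (1 + 1 / K / (\<epsilon> / 2)))"
  define \<alpha> where "\<alpha> = min (?L / 8) (\<eta> / (2 * K * (?L\<^sup>2 + ?L) + ?L + 2))"
  have L: "0 < ?L" using m_less_M by simp
  have "0 < \<delta>" using W_less by (simp add: \<delta>_def Dp_def)
  \<comment> \<open>\<open>bump\<close> vanishes at \<open>m\<close>. The resulting
    \<open>\<delta> \<le> Dp\<close> keeps \<open>D\<close> positive on the sublevel set.\<close>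
  have "0 \<le> W" using W[OF m_in_A] by (simp add: bump_def)
  then have "\<delta> \<le> Dp" by (simp add: \<delta>_def)
  have K: "0 < K" "K * \<delta> = ?L" using L \<open>0 < \<delta>\<close> by (simp_all add: K_def)
  have pos: "0 < ?L + 1 / K" "0 < 1 + 1 / K / (\<epsilon> / 2)" "0 < 2 * K * (?L\<^sup>2 + ?L) + ?L + 2"
    using L K \<epsilon> by (intro add_pos_pos mult_pos_pos divide_pos_pos zero_less_power; simp)+
  have \<eta>: "0 < \<eta>"
    unfolding \<eta>_def min_less_iff_conj using pos L \<epsilon> \<open>0 < \<delta>\<close>
    by (intro conjI divide_pos_pos mult_pos_pos) auto
  have \<eta>_D: "?L * \<eta> + \<eta> / K \<le> \<delta> / 2"
  proof -
    have "\<eta> \<le> \<delta> / 2 / (?L + 1 / K)" by (simp add: \<eta>_def)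
    then have "\<eta> * (?L + 1 / K) \<le> \<delta> / 2" using pos(1) by (simp only: pos_le_divide_eq)
    then show ?thesis by (simp add: algebra_simps)
  qed
  have \<eta>_levy: "\<eta> + \<eta> / K / (\<epsilon> / 2) \<le> ?L * (\<epsilon> / 2)"
  proof -
    have "\<eta> \<le> ?L * (\<epsilon> / 2) / (1 + 1 / K / (\<epsilon> / 2))" by (simp add: \<eta>_def)
    then have "\<eta> * (1 + 1 / K / (\<epsilon> / 2)) \<le> ?L * (\<epsilon> / 2)" using pos(2) by (simp only: pos_le_divide_eq)
    then show ?thesis by (simp add: algebra_simps)
  qed
  have H_bounds: "\<bar>\<mu>\<^sub>1 \<nu> - ?c\<bar> \<le> \<eta>" "defect \<nu> \<le> \<eta> / K" if "carried \<nu>" "H \<nu> \<le> \<eta>" for \<nu>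
  proof -
    have "0 \<le> K * defect \<nu>" using K defect_nonneg[OF that(1)] by simp
    then show "\<bar>\<mu>\<^sub>1 \<nu> - ?c\<bar> \<le> \<eta>" using that(2) by (simp add: H_def)
    have "K * defect \<nu> \<le> \<eta>" using that(2) by (simp add: H_def)
    then show "defect \<nu> \<le> \<eta> / K" using K by (simp add: pos_le_divide_eq mult.commute)
  qed
  have step: "carried (T (T \<nu>)) \<and> H (T (T \<nu>)) \<le> \<eta>" if \<nu>: "carried \<nu>" "H \<nu> \<le> \<eta>" for \<nu>
  proof -
    have "?L * \<bar>\<mu>\<^sub>1 \<nu> - ?c\<bar> \<le> ?L * \<eta>"
      using H_bounds[OF \<nu>] L by (intro mult_left_mono) auto
    then have D: "Dp - \<delta> / 2 \<le> D \<nu>"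
      using D_lower[OF \<nu>(1) p] H_bounds[OF \<nu>] \<eta>_D unfolding Dp_def by linarith
    then have D_pos: "0 < D \<nu>" using \<open>0 < \<delta>\<close> \<open>\<delta> \<le> Dp\<close> by linarith
    have "2 * \<delta> = 2 * Dp - W" by (simp add: \<delta>_def)
    then have "\<delta> \<le> 2 * D \<nu> - W" using D by linarith
    then have "?L \<le> K * (2 * D \<nu> - W)"
      using K mult_left_mono[of \<delta> "2 * D \<nu> - W" K] by simp
    then have "H (T (T \<nu>)) \<le> H \<nu>"
      unfolding H_def using K by (intro lyapunov_step[OF \<nu>(1) D_pos W]) auto
    then show ?thesis using carried_TT[OF \<nu>(1) D_pos] \<nu>(2) by simp
  qed
  have \<alpha>: "0 < \<alpha>" "4 * \<alpha> < ?L"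
  proof -
    show "0 < \<alpha>"
      unfolding \<alpha>_def min_less_iff_conj using L \<eta> pos(3) by (intro conjI divide_pos_pos) auto
    have "\<alpha> \<le> ?L / 8" unfolding \<alpha>_def by (rule min.cobounded1)
    then show "4 * \<alpha> < ?L" using L by simp
  qed
  have start: "H \<nu> \<le> \<eta>" if "carried \<nu>" "levy_dist \<nu> (two_point m M p) < \<alpha>" for \<nu>
  proof -
    have "\<alpha> \<le> \<eta> / (2 * K * (?L\<^sup>2 + ?L) + ?L + 2)" by (simp add: \<alpha>_def)
    then have "\<alpha> * (2 * K * (?L\<^sup>2 + ?L) + ?L + 2) \<le> \<eta>" using pos(3) by (simp only: pos_le_divide_eq)
    moreover have "H \<nu> \<le> K * (2 * \<alpha> * (?L\<^sup>2 + ?L)) + \<alpha> * (?L + 2)"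
      unfolding H_def using moments_near_two_point[OF that(1) p \<alpha> that(2)] K
      by (intro add_mono mult_left_mono) auto
    ultimately show ?thesis by (simp add: algebra_simps)
  qed
  have close: "levy_dist \<nu> (two_point m M p) < \<epsilon>" if \<nu>: "carried \<nu>" "H \<nu> \<le> \<eta>" for \<nu>
  proof -
    have "defect \<nu> / (\<epsilon> / 2) \<le> \<eta> / K / (\<epsilon> / 2)"
      using H_bounds[OF \<nu>] \<epsilon> by (intro divide_right_mono) auto
    then have "levy_dist \<nu> (two_point m M p) \<le> \<epsilon> / 2"
      using H_bounds[OF \<nu>] \<eta>_levy \<epsilon> by (intro levy_dist_two_point_le[OF \<nu>(1) p]) linarith+
    then show ?thesis using \<epsilon> by simp
  qed
  show "\<exists>\<alpha>>0. \<forall>y\<in>measures_on A m M. levy_dist y (two_point m M p) < \<alpha> \<longrightarrow>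
      (\<forall>n>0. levy_dist (((T \<circ> T) ^^ n) y) (two_point m M p) < \<epsilon>)"
  proof (intro exI[of _ \<alpha>] conjI ballI impI allI \<alpha>(1))
    fix \<nu> n assume "\<nu> \<in> measures_on A m M" "levy_dist \<nu> (two_point m M p) < \<alpha>"
    then have \<nu>: "carried \<nu>" "H \<nu> \<le> \<eta>" using measures_onD start by blast+
    have "carried (((T \<circ> T) ^^ n) \<nu>) \<and> H (((T \<circ> T) ^^ n) \<nu>) \<le> \<eta>"
      by (induction n) (use \<nu> step in auto)
    then show "levy_dist (((T \<circ> T) ^^ n) \<nu>) (two_point m M p) < \<epsilon>"
      using close by blast
  qed
qed

section \<open>Instability\<close>

lemma mass_TT:
  assumes "carried \<nu>" "0 < D \<nu>"
  shows "D \<nu> * D (T \<nu>) * measure (T (T \<nu>)) {l} = ((l - \<mu>\<^sub>1 \<nu>) * (l - \<mu>\<^sub>1 (T \<nu>)))\<^sup>2 * measure \<nu> {l}"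
proof -
  interpret TT: real_distribution "T (T \<nu>)"
    using carried_TT[OF assms] by (rule carried_real_distribution)
  interpret \<nu>: real_distribution \<nu>
    using assms(1) by (rule carried_real_distribution)
  have "D \<nu> * D (T \<nu>) * measure (T (T \<nu>)) {l} = (\<integral>x. indicator {l} x * (D \<nu> - residual \<nu> x)\<^sup>2 \<partial>\<nu>)"
    using integral_TT[OF assms D_T_pos[OF assms], of "indicator {l}"] by simp
  also have "\<dots> = (\<integral>x. ((l - \<mu>\<^sub>1 \<nu>) * (l - \<mu>\<^sub>1 (T \<nu>)))\<^sup>2 * indicator {l} x \<partial>\<nu>)"
    by (intro Bochner_Integration.integral_cong refl) (simp add: residual_def indicator_def)
  finally show ?thesis by simp
qed

text \<open>At the fixed point the means of the two steps are \<open>c\<close> and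
  \<open>m + M - c\<close>, both variances are \<open>Dp\<close>, and an atom at \<open>l\<close> is
  multiplied by \<open>(bump l - Dp)\<^sup>2 / Dp\<^sup>2\<close>. This exceeds 1 since
  \<open>bump l > 2 * Dp\<close>, and continuity gives a uniform \<kappa> nearby.\<close>

lemma mass_growth:
  assumes p: "0 < p" "p < 1" and l: "2 * (p * (1 - p) * (M - m)\<^sup>2) < bump l"
  obtains \<kappa> \<eta> where "1 < \<kappa>" "0 < \<eta>"
    "\<And>\<nu>. carried \<nu> \<Longrightarrow> \<bar>\<mu>\<^sub>1 \<nu> - (p * m + (1 - p) * M)\<bar> \<le> \<eta> \<Longrightarrow> defect \<nu> \<le> \<eta> \<Longrightarrow>
      carried (T (T \<nu>)) \<and> \<kappa> * measure \<nu> {l} \<le> measure (T (T \<nu>)) {l}"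
proof -
  define c where "c = p * m + (1 - p) * M"
  define Dp where "Dp = p * (1 - p) * (M - m)\<^sup>2"
  have L: "0 < M - m" using m_less_M by simp
  have Dp: "0 < Dp" using p L by (simp add: Dp_def)
  have bump_c: "bump c = Dp" "bump (m + M - c) = Dp"
    unfolding c_def Dp_def bump_def by (simp_all add: power2_eq_square algebra_simps)
  have "Dp\<^sup>2 < (bump l - Dp)\<^sup>2"
    using l Dp by (intro power_strict_mono) (auto simp: Dp_def)
  then have "1 < (bump l - Dp)\<^sup>2 / Dp\<^sup>2" using Dp by simp
  then obtain \<kappa> where \<kappa>: "1 < \<kappa>" "\<kappa> < (bump l - Dp)\<^sup>2 / Dp\<^sup>2" using dense by blast
  \<comment> \<open>\<open>bump\<close> at the two means is an upper bound for the two variances.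
    With it in their place the condition depends on the pair of means alone and is open in the
    plane.\<close>
  define U where "U = {z. \<kappa> * (bump (fst z) * bump (snd z)) < ((l - fst z) * (l - snd z))\<^sup>2}"
  have "open U"
    unfolding U_def bump_def by (intro open_Collect_less continuous_intros)
  moreover have "(c, m + M - c) \<in> U"
  proof -
    have "(l - c) * (l - (m + M - c)) = bump c - bump l"
      by (simp add: bump_def algebra_simps)
    then show ?thesis
      using \<kappa>(2) Dp by (simp add: U_def bump_c pos_less_divide_eq power2_eq_square) (simp add: algebra_simps)
  qed
  ultimately obtain \<rho> where \<rho>: "0 < \<rho>" "ball (c, m + M - c) \<rho> \<subseteq> U"
    using openE by blast
  \<comment> \<open>The first bound gives \<open>D \<nu> \<ge> Dp / 2\<close>. The second puts the
    pair of means within \<open>\<rho> / 2\<close> of its limit: the error of the first mean counts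
    twice, and \<open>mean_T_near\<close> adds the last term.\<close>
  define \<eta> where "\<eta> = min (Dp / 2 / (M - m + 1)) (\<rho> / 2 / (2 + (M - m) / (Dp / 2)))"
  have pos: "0 < M - m + 1" "0 < 2 + (M - m) / (Dp / 2)"
    using L Dp by (intro add_pos_pos divide_pos_pos; simp)+
  have \<eta>: "0 < \<eta>"
    unfolding \<eta>_def min_less_iff_conj using pos Dp \<rho>(1) by (intro conjI divide_pos_pos) auto
  have \<eta>_D: "(M - m) * \<eta> + \<eta> \<le> Dp / 2"
  proof -
    have "\<eta> \<le> Dp / 2 / (M - m + 1)" by (simp add: \<eta>_def)
    then have "\<eta> * (M - m + 1) \<le> Dp / 2" using pos(1) by (simp only: pos_le_divide_eq)
    then show ?thesis by (simp add: algebra_simps)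
  qed
  have \<eta>_\<rho>: "\<eta> + \<eta> + (M - m) * \<eta> / (Dp / 2) \<le> \<rho> / 2"
  proof -
    have "\<eta> \<le> \<rho> / 2 / (2 + (M - m) / (Dp / 2))" by (simp add: \<eta>_def)
    then have "\<eta> * (2 + (M - m) / (Dp / 2)) \<le> \<rho> / 2" using pos(2) by (simp only: pos_le_divide_eq)
    then show ?thesis by (simp add: algebra_simps)
  qed
  have "carried (T (T \<nu>)) \<and> \<kappa> * measure \<nu> {l} \<le> measure (T (T \<nu>)) {l}"
    if \<nu>: "carried \<nu>" and near: "\<bar>\<mu>\<^sub>1 \<nu> - c\<bar> \<le> \<eta>" "defect \<nu> \<le> \<eta>" for \<nu>
  proof -
    let ?a = "\<mu>\<^sub>1 \<nu>" and ?a' = "\<mu>\<^sub>1 (T \<nu>)"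
    have "(M - m) * \<bar>?a - c\<bar> \<le> (M - m) * \<eta>"
      using near L by (intro mult_left_mono) auto
    then have D: "Dp / 2 \<le> D \<nu>"
      using D_lower[OF \<nu> p] near(2) \<eta>_D unfolding Dp_def c_def by linarith
    then have D_pos: "0 < D \<nu>" using Dp by linarith
    note T_carried = carried_T[OF \<nu> D_pos] and D_T = D_T_pos[OF \<nu> D_pos]
    have "(M - m) * defect \<nu> / D \<nu> \<le> (M - m) * \<eta> / (Dp / 2)"
      using near(2) D Dp L \<eta> by (intro frac_le mult_left_mono) auto
    then have "\<bar>?a' - (m + M - ?a)\<bar> \<le> (M - m) * \<eta> / (Dp / 2)"
      using mean_T_near[OF \<nu> D_pos] by linarith
    then have "\<bar>?a - c\<bar> + \<bar>?a' - (m + M - c)\<bar> \<le> \<rho> / 2"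
      using near(1) \<eta>_\<rho> by linarith
    moreover have "dist (?a, ?a') (c, m + M - c) \<le> \<bar>?a - c\<bar> + \<bar>?a' - (m + M - c)\<bar>"
      unfolding dist_prod_def dist_real_def by (simp add: sqrt_sum_squares_le_sum_abs)
    ultimately have "(?a, ?a') \<in> ball (c, m + M - c) \<rho>"
      using \<rho>(1) by (simp add: dist_commute)
    then have growth: "\<kappa> * (bump ?a * bump ?a') \<le> ((l - ?a) * (l - ?a'))\<^sup>2"
      using \<rho>(2) by (auto simp: U_def)
    have "D \<nu> \<le> bump ?a" "D (T \<nu>) \<le> bump ?a'"
      using D_eq_defect[OF \<nu>] D_eq_defect[OF T_carried] defect_nonneg[OF \<nu>] defect_nonneg[OF T_carried]
      by (simp_all add: bump_def)
    then have "D \<nu> * D (T \<nu>) \<le> bump ?a * bump ?a'"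
      using D_pos D_T by (intro mult_mono) auto
    then have "\<kappa> * (D \<nu> * D (T \<nu>)) \<le> ((l - ?a) * (l - ?a'))\<^sup>2"
      using growth \<kappa>(1) mult_left_mono[of "D \<nu> * D (T \<nu>)" "bump ?a * bump ?a'" \<kappa>] by linarith
    then have "\<kappa> * (D \<nu> * D (T \<nu>)) * measure \<nu> {l} \<le> D \<nu> * D (T \<nu>) * measure (T (T \<nu>)) {l}"
      unfolding mass_TT[OF \<nu> D_pos] by (intro mult_right_mono) auto
    then have "D \<nu> * D (T \<nu>) * (\<kappa> * measure \<nu> {l}) \<le> D \<nu> * D (T \<nu>) * measure (T (T \<nu>)) {l}"
      by (simp only: mult_ac)
    then show ?thesis
      using D_pos D_T carried_TT[OF \<nu> D_pos] by simp
  qed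
  with \<kappa>(1) \<eta> show ?thesis using that unfolding c_def by blast
qed

text \<open>Mixing with weight \<open>t\<close> changes the cdf by at most \<open>t\<close> at each
  point; monotonicity of the two-point cdf absorbs the shifts.\<close>

lemma levy_dist_three_point_le:
  assumes "0 < p" "p < 1" "0 < t" "t < 1"
  shows "levy_dist (three_point m M p l t) (two_point m M p) \<le> t"
proof (rule levy_dist_le[OF real_distribution_three_point real_distribution_two_point])
  interpret two: real_distribution "two_point m M p" by (rule real_distribution_two_point)
  fix x
  let ?F = "cdf (two_point m M p)" and ?G = "cdf (three_point m M p l t)"
  have G: "?G x = t * indicator {..x} l + (1 - t) * ?F x"
    using assms by (simp add: cdf_def measure_three_point measure_two_point)
  have F: "0 \<le> t * ?F x" "t * ?F x \<le> t"
    using assms two.cdf_nonneg two.cdf_bounded_prob by (simp_all add: mult_left_le)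
  have ind: "0 \<le> t * indicator {..x} l" "t * indicator {..x} l \<le> t"
    using assms by (simp_all add: indicator_def)
  have "?F (x - t) \<le> ?F x" "?F x \<le> ?F (x + t)"
    using assms by (auto intro!: two.cdf_nondecreasing)
  moreover have "(1 - t) * ?F x = ?F x - t * ?F x" by (simp add: algebra_simps)
  ultimately show "?F (x - t) - t \<le> ?G x" "?G x \<le> ?F (x + t) + t"
    using G F ind by linarith+
qed

text \<open>Under stability, the orbit of a three-point measure with small \<open>t\<close> would
  stay where each double step multiplies the mass at \<open>l\<close> by at least \<kappa>, and that
  mass would eventually exceed 1.\<close>

theorem unstable_two_point:
  assumes p: "0 < p" "p < 1" and l: "l \<in> A" "2 * (p * (1 - p) * (M - m)\<^sup>2) < bump l"
  shows "unstable_fixed_point (measures_on A m M) levy_dist (T \<circ> T) (two_point m M p)"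
  unfolding unstable_fixed_point_def
proof (intro conjI notI fixed_point_two_point[OF p])
  assume stable: "stable_fixed_point (measures_on A m M) levy_dist (T \<circ> T) (two_point m M p)"
  let ?L = "M - m"
  have L: "0 < ?L" using m_less_M by simp
  obtain \<kappa> \<eta> where \<kappa>: "1 < \<kappa>" and \<eta>: "0 < \<eta>" and growth:
    "\<And>\<nu>. carried \<nu> \<Longrightarrow> \<bar>\<mu>\<^sub>1 \<nu> - (p * m + (1 - p) * M)\<bar> \<le> \<eta> \<Longrightarrow> defect \<nu> \<le> \<eta> \<Longrightarrow>
      carried (T (T \<nu>)) \<and> \<kappa> * measure \<nu> {l} \<le> measure (T (T \<nu>)) {l}"
    using mass_growth[OF p l(2)] by blast
  define \<epsilon> where "\<epsilon> = min (?L / 8) (\<eta> / (2 * (?L\<^sup>2 + ?L) + (?L + 2)))"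
  have pos: "0 < 2 * (?L\<^sup>2 + ?L) + (?L + 2)"
    using L by (intro add_pos_pos mult_pos_pos zero_less_power) auto
  have \<epsilon>: "0 < \<epsilon>" "4 * \<epsilon> < ?L"
  proof -
    show "0 < \<epsilon>"
      unfolding \<epsilon>_def min_less_iff_conj using L \<eta> pos by (intro conjI divide_pos_pos) auto
    have "\<epsilon> \<le> ?L / 8" unfolding \<epsilon>_def by (rule min.cobounded1)
    then show "4 * \<epsilon> < ?L" using L by simp
  qed
  have "\<epsilon> \<le> \<eta> / (2 * (?L\<^sup>2 + ?L) + (?L + 2))" by (simp add: \<epsilon>_def)
  then have "\<epsilon> * (2 * (?L\<^sup>2 + ?L) + (?L + 2)) \<le> \<eta>" using pos by (simp only: pos_le_divide_eq)
  moreover have "0 \<le> 2 * \<epsilon> * (?L\<^sup>2 + ?L)" "0 \<le> \<epsilon> * (?L + 2)"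
    using \<epsilon> L by simp_all
  ultimately have \<epsilon>_\<eta>: "2 * \<epsilon> * (?L\<^sup>2 + ?L) \<le> \<eta>" "\<epsilon> * (?L + 2) \<le> \<eta>"
    by (simp_all add: algebra_simps)
  have step: "carried (T (T \<nu>)) \<and> \<kappa> * measure \<nu> {l} \<le> measure (T (T \<nu>)) {l}"
    if "carried \<nu>" "levy_dist \<nu> (two_point m M p) < \<epsilon>" for \<nu>
    using moments_near_two_point[OF that(1) p \<epsilon> that(2)] \<epsilon>_\<eta> by (intro growth that(1)) linarith+
  obtain \<alpha> where \<alpha>: "0 < \<alpha>" and iterates:
    "\<And>\<nu> n. \<nu> \<in> measures_on A m M \<Longrightarrow> levy_dist \<nu> (two_point m M p) < \<alpha> \<Longrightarrow> 0 < n \<Longrightarrow>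
      levy_dist (((T \<circ> T) ^^ n) \<nu>) (two_point m M p) < \<epsilon>"
    using stable \<epsilon>(1) unfolding stable_fixed_point_def by blast
  \<comment> \<open>Below \<alpha> so that stability applies to the start, and below \<epsilon>
    because stability speaks only of \<open>n > 0\<close> and the case \<open>n = 0\<close> is also
    needed.\<close>
  define t where "t = min (1 / 2) (min (\<alpha> / 2) (\<epsilon> / 2))"
  have t: "0 < t" "t < 1" "t < \<alpha>" "t < \<epsilon>"
    using \<alpha> \<epsilon>(1) by (auto simp: t_def min_def)
  define \<nu> where "\<nu> = three_point m M p l t"
  define S where "S n = ((T \<circ> T) ^^ n) \<nu>" for n
  have \<nu>: "\<nu> \<in> measures_on A m M" "levy_dist \<nu> (two_point m M p) \<le> t"
    unfolding \<nu>_def using p t l three_point_in levy_dist_three_point_le by auto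
  have near: "levy_dist (S n) (two_point m M p) < \<epsilon>" for n
    using iterates[OF \<nu>(1), of n] \<nu>(2) t by (cases n) (auto simp: S_def)
  have mass: "carried (S n) \<and> \<kappa> ^ n * t \<le> measure (S n) {l}" for n
  proof (induction n)
    case 0
    have "0 \<le> (1 - t) * (p * indicator {l} m + (1 - p) * indicator {l} M)"
      using p t by (intro mult_nonneg_nonneg add_nonneg_nonneg) auto
    then show ?case
      using \<nu>(1) measures_onD p t by (simp add: S_def \<nu>_def measure_three_point)
  next
    case (Suc n)
    then have "\<kappa> * (\<kappa> ^ n * t) \<le> \<kappa> * measure (S n) {l}"
      using \<kappa> by (intro mult_left_mono) auto
    moreover have "S (Suc n) = T (T (S n))" by (simp add: S_def)
    ultimately show ?case
      using step[of "S n"] Suc near by (simp add: mult.assoc)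
  qed
  obtain n where "1 / t < \<kappa> ^ n" using real_arch_pow[OF \<kappa>] by blast
  then have "1 < \<kappa> ^ n * t" using t by (simp add: pos_divide_less_eq)
  moreover have "measure (S n) {l} \<le> 1"
    using mass[of n] carried_real_distribution real_distribution.axioms(1) prob_space.prob_le_1 by blast
  ultimately show False using mass[of n] by linarith
qed

end

section \<open>Translation of the intervals for \<open>p\<close> into the sign of the margin\<close>

lemma s_nonneg: "m < M \<Longrightarrow> 0 \<le> s m M x"
  by (simp add: s_def)

lemma s_square:
  assumes "m < M"
  shows "(2 * (M - m) * s m M x)\<^sup>2 = (M - m)\<^sup>2 - 2 * ((M - x) * (x - m))"
proof -
  have "(2 * (M - m) * s m M x)\<^sup>2 = (M - x)\<^sup>2 + (x - m)\<^sup>2"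
    using assms by (simp add: s_def)
  then show ?thesis by (simp add: power2_eq_square algebra_simps)
qed

text \<open>Complete the square, \<open>p * (1 - p) = 1/4 - (p - 1/2)\<^sup>2\<close>, and use
  \<open>s_square\<close>. The sign of the margin thus compares the distance of \<open>p\<close>
  from 1/2 with \<open>s m M x\<close>.\<close>

lemma stability_margin_eq:
  assumes "m < M"
  shows "2 * (p * (1 - p) * (M - m)\<^sup>2) - (M - x) * (x - m) =
    2 * (M - m)\<^sup>2 * ((s m M x)\<^sup>2 - (p - 1 / 2)\<^sup>2)"
  using s_square[OF assms, of x] by (simp add: power_mult_distrib) (simp add: power2_eq_square algebra_simps)

text \<open>By \<open>s_square\<close> a minimiser \<open>l\<close> of \<open>s\<close> maximises
  \<open>bump\<close> on \<open>A\<close>. So \<open>bump l\<close> serves as the bound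
  \<open>W\<close> in the stable case, and \<open>l\<close> as the place of the growing atom in the
  unstable one.\<close>

theorem theorem5:
  fixes m M l :: real and A :: "real set"
  assumes "0 < m" and "m < M"
    and "closed A" and "A \<subseteq> {m..M}" and "m \<in> A" and "M \<in> A"
    and "is_arg_min (s m M) (\<lambda>x. x \<in> A) l"
  shows "(\<forall>p\<in>{0<..<1}. fixed_point (measures_on A m M) (T \<circ> T) (two_point m M p)) \<and>
    (\<forall>p\<in>{0<..<1/2 - s m M l} \<union> {1/2 + s m M l<..<1}.
      unstable_fixed_point (measures_on A m M) levy_dist (T \<circ> T) (two_point m M p)) \<and>
    (\<forall>p\<in>{1/2 - s m M l<..<1/2 + s m M l}.
      stable_fixed_point (measures_on A m M) levy_dist (T \<circ> T) (two_point m M p))"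
proof -
  interpret compact_interval_set m M A
    using assms by unfold_locales
  have l: "l \<in> A" and l_min: "\<And>x. x \<in> A \<Longrightarrow> s m M l \<le> s m M x"
    using assms(7) by (auto simp: is_arg_min_def not_less)
  note s_l = s_nonneg[OF assms(2), of l]
  \<comment> \<open>As \<open>m\<close> lies in \<open>A\<close>, the minimum of \<open>s\<close> is
    at most 1/2, which puts the stable interval inside (0, 1).\<close>
  have "s m M m = 1 / 2" using assms(2) by (simp add: s_def)
  then have s_half: "s m M l \<le> 1 / 2" using l_min[OF assms(5)] by simp
  have scale: "0 < 2 * (M - m)\<^sup>2" using assms(2) by simp
  have bump_le: "bump x \<le> bump l" if "x \<in> A" for x
  proof -
    have "(2 * (M - m) * s m M l)\<^sup>2 \<le> (2 * (M - m) * s m M x)\<^sup>2"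
      using l_min[OF that] s_l assms(2) by (intro power_mono mult_left_mono) auto
    then show ?thesis unfolding s_square[OF assms(2)] bump_def by linarith
  qed
  have unstable: "unstable_fixed_point (measures_on A m M) levy_dist (T \<circ> T) (two_point m M p)"
    if "p \<in> {0<..<1/2 - s m M l} \<union> {1/2 + s m M l<..<1}" for p
  proof (rule unstable_two_point[OF _ _ l])
    show "0 < p" "p < 1" using that s_l by auto
    have "\<bar>s m M l\<bar> < \<bar>p - 1 / 2\<bar>" using that s_l by auto
    then have "(s m M l)\<^sup>2 < (p - 1 / 2)\<^sup>2" by (simp add: abs_le_square_iff flip: not_le)
    then have "2 * (M - m)\<^sup>2 * ((s m M l)\<^sup>2 - (p - 1 / 2)\<^sup>2) < 0"
      using scale by (intro mult_pos_neg) auto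
    then show "2 * (p * (1 - p) * (M - m)\<^sup>2) < bump l"
      unfolding stability_margin_eq[OF assms(2), symmetric] by (simp add: bump_def)
  qed
  have stable: "stable_fixed_point (measures_on A m M) levy_dist (T \<circ> T) (two_point m M p)"
    if "p \<in> {1/2 - s m M l<..<1/2 + s m M l}" for p
  proof (rule stable_two_point[where W = "bump l"])
    show "0 < p" "p < 1" using that s_half by auto
    have "\<bar>p - 1 / 2\<bar> < \<bar>s m M l\<bar>" using that s_l by auto
    then have "(p - 1 / 2)\<^sup>2 < (s m M l)\<^sup>2" by (simp add: abs_le_square_iff flip: not_le)
    then have "0 < 2 * (M - m)\<^sup>2 * ((s m M l)\<^sup>2 - (p - 1 / 2)\<^sup>2)"
      using scale by (intro mult_pos_pos) auto
    then show "bump l < 2 * (p * (1 - p) * (M - m)\<^sup>2)"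
      unfolding stability_margin_eq[OF assms(2), symmetric] by (simp add: bump_def)
  qed (rule bump_le)
  show ?thesis
    using fixed_point_two_point unstable stable by auto
qed

end
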